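(* Let $\mathcal{A}$ be an abelian length category and let $[\mathcal{G},\mathcal{F}]$ be an interval in $\mathsf{torf}\,\mathcal{A}$. Then the following are equivalent. (1) $\mathcal{F}^-\subseteq\mathcal{G}\subseteq\mathcal{F}$ holds. (2) There is a torsion-free class $\mathcal{G}'$ in $\mathcal{A}$ with $\mathcal{G}'\subseteq\mathcal{G}\subseteq\mathcal{F}$ such that $[\mathcal{G}',\mathcal{F}]$ is a wide interval. (3) $[\mathcal{G},\mathcal{F}]$ is an ICE interval. Moreover, for any $\mathcal{G}'$ as in (2), $\mathcal{H}_{[\mathcal{G},\mathcal{F}]}$ is a torsion class in the wide subcategory $\mathcal{H}_{[\mathcal{G}',\mathcal{F}]}$. In particular, if $[\mathcal{G},\mathcal{F}]$ is an ICE interval, then $\mathcal{H}_{[\mathcal{G},\mathcal{F}]}$ is a torsion class in $\mathsf{W}_R(\mathcal{F})$.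
   Context: All categories are skeletally small; an abelian length category is an abelian category in which every object has finite length. Subcategories are full, closed under isomorphisms, and contain the zero object. A torsion class (resp. torsion-free class) in an abelian length category is a subcategory closed under extensions and quotients (resp. extensions and subobjects). $\mathsf{torf}\,\mathcal{A}$ is the complete lattice of torsion-free classes in $\mathcal{A}$ ordered by inclusion. For $\mathcal{G}\subseteq\mathcal{F}$ in $\mathsf{torf}\,\mathcal{A}$, $[\mathcal{G},\mathcal{F}]$ is the interval between them, and its heart is $\mathcal{H}_{[\mathcal{G},\mathcal{F}]}:=\mathcal{F}\cap{}^\perp\mathcal{G}$, where ${}^\perp\mathcal{G}=\{M\in\mathcal{A}\mid\mathrm{Hom}_{\mathcal{A}}(M,G)=0\text{ for all }G\in\mathcal{G}\}$. A subcategory $\mathcal{C}$ is wide if closed under extensions, and under kernels and cokernels (in $\mathcal{A}$) of morphisms between objects of $\mathcal{C}$ (it is then itself an abelian length category); ICE-closed if closed under extensions, and under images and cokernels (in $\mathcal{A}$) of morphisms between objects of $\mathcal{C}$. $[\mathcal{G},\mathcal{F}]$ is a wide interval (resp. ICE interval) if its heart is a wide (resp. ICE-closed) subcategory of $\mathcal{A}$. The Hasse quiver of a poset has an arrow $p\to q$ whenever $p>q$ and there is no $r$ with $p>r>q$. For $\mathcal{F}\in\mathsf{torf}\,\mathcal{A}$, $\mathsf{W}_R(\mathcal{F}):=\{X\in\mathcal{F}\mid\text{for every morphism }\varphi\colon X\to F\text{ with }F\in\mathcal{F},\ \mathrm{Coker}\,\varphi\in\mathcal{F}\}$, which is known to be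 a wide subcategory of $\mathcal{A}$, and $\mathcal{F}^-:=\mathcal{F}\cap\mathsf{W}_R(\mathcal{F})^\perp=\mathcal{F}\cap\bigcap\{\mathcal{F}'\in\mathsf{torf}\,\mathcal{A}\mid\text{there is an arrow }\mathcal{F}\to\mathcal{F}'\text{ in the Hasse quiver of }\mathsf{torf}\,\mathcal{A}\}$ (the two expressions are known to agree), where $\mathcal{C}^\perp=\{M\in\mathcal{A}\mid\mathrm{Hom}_{\mathcal{A}}(C,M)=0\text{ for all }C\in\mathcal{C}\}$. *)

theory Defs
  imports "HOL-Algebra.Group"
begin

text \<open>
  A category carries addition and zero morphisms as data, so that it can be required to be
  preadditive. Composition, addition and identities are only meaningful on the relevant arrows
  and objects. A category with a set of objects in HOL is small; every skeletally small category
  is equivalent to one of this form.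
\<close>

record ('o, 'm) category =
  Obj :: "'o set"
  Arr :: "'m set"
  Dom :: "'m \<Rightarrow> 'o"
  Cod :: "'m \<Rightarrow> 'o"
  Ident :: "'o \<Rightarrow> 'm"
  Comp :: "'m \<Rightarrow> 'm \<Rightarrow> 'm"  (infixl "\<cdot>\<index>" 70)
  Add :: "'m \<Rightarrow> 'm \<Rightarrow> 'm"  (infixl "\<boxplus>\<index>" 65)
  Zero :: "'o \<Rightarrow> 'o \<Rightarrow> 'm"

definition Hom :: "('o, 'm) category \<Rightarrow> 'o \<Rightarrow> 'o \<Rightarrow> 'm set" where
  "Hom C X Y = {f \<in> Arr C. Dom C f = X \<and> Cod C f = Y}"

definition hom_group :: "('o, 'm) category \<Rightarrow> 'o \<Rightarrow> 'o \<Rightarrow> 'm monoid" where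
  "hom_group C X Y = \<lparr>carrier = Hom C X Y, mult = Add C, one = Zero C X Y\<rparr>"

definition full_subcategory :: "('o, 'm) category \<Rightarrow> 'o set \<Rightarrow> ('o, 'm) category" where
  "full_subcategory C S =
     C\<lparr>Obj := S, Arr := {f \<in> Arr C. Dom C f \<in> S \<and> Cod C f \<in> S}\<rparr>"

definition monic :: "('o, 'm) category \<Rightarrow> 'm \<Rightarrow> bool" where
  "monic C f \<longleftrightarrow> f \<in> Arr C \<and>
     (\<forall>W\<in>Obj C. \<forall>g\<in>Hom C W (Dom C f). \<forall>h\<in>Hom C W (Dom C f).
        f \<cdot>\<^bsub>C\<^esub> g = f \<cdot>\<^bsub>C\<^esub> h \<longrightarrow> g = h)"

definition epic :: "('o, 'm) category \<Rightarrow> 'm \<Rightarrow> bool" where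
  "epic C f \<longleftrightarrow> f \<in> Arr C \<and>
     (\<forall>W\<in>Obj C. \<forall>g\<in>Hom C (Cod C f) W. \<forall>h\<in>Hom C (Cod C f) W.
        g \<cdot>\<^bsub>C\<^esub> f = h \<cdot>\<^bsub>C\<^esub> f \<longrightarrow> g = h)"

definition is_iso :: "('o, 'm) category \<Rightarrow> 'm \<Rightarrow> bool" where
  "is_iso C f \<longleftrightarrow> f \<in> Arr C \<and>
     (\<exists>g\<in>Hom C (Cod C f) (Dom C f).
        g \<cdot>\<^bsub>C\<^esub> f = Ident C (Dom C f) \<and> f \<cdot>\<^bsub>C\<^esub> g = Ident C (Cod C f))"

definition isomorphic :: "('o, 'm) category \<Rightarrow> 'o \<Rightarrow> 'o \<Rightarrow> bool" where
  "isomorphic C X Y \<longleftrightarrow> (\<exists>f\<in>Hom C X Y. is_iso C f)"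

definition zero_object :: "('o, 'm) category \<Rightarrow> 'o \<Rightarrow> bool" where
  "zero_object C Z \<longleftrightarrow> Z \<in> Obj C \<and>
     (\<forall>X\<in>Obj C. (\<exists>!f. f \<in> Hom C X Z) \<and> (\<exists>!f. f \<in> Hom C Z X))"

definition is_kernel :: "('o, 'm) category \<Rightarrow> 'm \<Rightarrow> 'm \<Rightarrow> bool" where
  "is_kernel C f k \<longleftrightarrow> f \<in> Arr C \<and> k \<in> Arr C \<and> Cod C k = Dom C f \<and>
     f \<cdot>\<^bsub>C\<^esub> k = Zero C (Dom C k) (Cod C f) \<and>
     (\<forall>h\<in>Arr C. Cod C h = Dom C f \<and> f \<cdot>\<^bsub>C\<^esub> h = Zero C (Dom C h) (Cod C f) \<longrightarrow>
        (\<exists>!u. u \<in> Hom C (Dom C h) (Dom C k) \<and> k \<cdot>\<^bsub>C\<^esub> u = h))"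

definition is_cokernel :: "('o, 'm) category \<Rightarrow> 'm \<Rightarrow> 'm \<Rightarrow> bool" where
  "is_cokernel C f c \<longleftrightarrow> f \<in> Arr C \<and> c \<in> Arr C \<and> Dom C c = Cod C f \<and>
     c \<cdot>\<^bsub>C\<^esub> f = Zero C (Dom C f) (Cod C c) \<and>
     (\<forall>h\<in>Arr C. Dom C h = Cod C f \<and> h \<cdot>\<^bsub>C\<^esub> f = Zero C (Dom C f) (Cod C h) \<longrightarrow>
        (\<exists>!u. u \<in> Hom C (Cod C c) (Cod C h) \<and> u \<cdot>\<^bsub>C\<^esub> c = h))"

definition is_image :: "('o, 'm) category \<Rightarrow> 'm \<Rightarrow> 'm \<Rightarrow> bool" where
  "is_image C f m \<longleftrightarrow> (\<exists>c. is_cokernel C f c \<and> is_kernel C c m)"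

text \<open>\<open>f\<close> and \<open>g\<close> form a short exact sequence \<open>0 \<rightarrow> X \<rightarrow> Y \<rightarrow> Z \<rightarrow> 0\<close>.\<close>

definition short_exact :: "('o, 'm) category \<Rightarrow> 'm \<Rightarrow> 'm \<Rightarrow> bool" where
  "short_exact C f g \<longleftrightarrow> is_kernel C g f \<and> is_cokernel C f g"

definition simple_object :: "('o, 'm) category \<Rightarrow> 'o \<Rightarrow> bool" where
  "simple_object C S \<longleftrightarrow> S \<in> Obj C \<and> \<not> zero_object C S \<and>
     (\<forall>m. monic C m \<and> Cod C m = S \<longrightarrow> zero_object C (Dom C m) \<or> is_iso C m)"

text \<open>Finite length means that there is a composition series
  \<open>0 = X 0 \<rightarrow> X 1 \<rightarrow> \<dots> \<rightarrow> X n = A\<close> with simple factors.\<close>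

definition finite_length :: "('o, 'm) category \<Rightarrow> 'o \<Rightarrow> bool" where
  "finite_length C A \<longleftrightarrow>
     (\<exists>(n::nat) X f g. zero_object C (X 0) \<and> X n = A \<and>
        (\<forall>i<n. f i \<in> Hom C (X i) (X (Suc i)) \<and> short_exact C (f i) (g i) \<and>
               simple_object C (Cod C (g i))))"

locale is_category =
  fixes C :: "('o, 'm) category" (structure)
  assumes Dom_Obj: "f \<in> Arr C \<Longrightarrow> Dom C f \<in> Obj C"
    and Cod_Obj: "f \<in> Arr C \<Longrightarrow> Cod C f \<in> Obj C"
    and Ident_Hom: "X \<in> Obj C \<Longrightarrow> Ident C X \<in> Hom C X X"
    and Comp_Hom: "f \<in> Hom C X Y \<Longrightarrow> g \<in> Hom C Y Z \<Longrightarrow> g \<cdot> f \<in> Hom C X Z"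
    and Comp_assoc: "f \<in> Hom C W X \<Longrightarrow> g \<in> Hom C X Y \<Longrightarrow> h \<in> Hom C Y Z \<Longrightarrow>
      (h \<cdot> g) \<cdot> f = h \<cdot> (g \<cdot> f)"
    and Comp_Ident: "f \<in> Hom C X Y \<Longrightarrow> f \<cdot> Ident C X = f"
    and Ident_Comp: "f \<in> Hom C X Y \<Longrightarrow> Ident C Y \<cdot> f = f"

locale preadditive_category = is_category +
  assumes Hom_comm_group: "X \<in> Obj C \<Longrightarrow> Y \<in> Obj C \<Longrightarrow> comm_group (hom_group C X Y)"
    and Comp_Add_left: "f \<in> Hom C X Y \<Longrightarrow> g \<in> Hom C Y Z \<Longrightarrow> h \<in> Hom C Y Z \<Longrightarrow>
      (g \<boxplus> h) \<cdot> f = (g \<cdot> f) \<boxplus> (h \<cdot> f)"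
    and Comp_Add_right: "f \<in> Hom C X Y \<Longrightarrow> g \<in> Hom C X Y \<Longrightarrow> h \<in> Hom C Y Z \<Longrightarrow>
      h \<cdot> (f \<boxplus> g) = (h \<cdot> f) \<boxplus> (h \<cdot> g)"

locale additive_category = preadditive_category +
  assumes zero_object_ex: "\<exists>Z. zero_object C Z"
    and biproduct_ex: "X \<in> Obj C \<Longrightarrow> Y \<in> Obj C \<Longrightarrow>
      \<exists>B\<in>Obj C. \<exists>i\<in>Hom C X B. \<exists>j\<in>Hom C Y B. \<exists>p\<in>Hom C B X. \<exists>q\<in>Hom C B Y.
        p \<cdot> i = Ident C X \<and> q \<cdot> j = Ident C Y \<and> (i \<cdot> p) \<boxplus> (j \<cdot> q) = Ident C B"

locale abelian_category = additive_category +
  assumes kernel_ex: "f \<in> Arr C \<Longrightarrow> \<exists>k. is_kernel C f k"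
    and cokernel_ex: "f \<in> Arr C \<Longrightarrow> \<exists>c. is_cokernel C f c"
    and monic_normal: "monic C f \<Longrightarrow> \<exists>g. is_kernel C g f"
    and epic_normal: "epic C f \<Longrightarrow> \<exists>g. is_cokernel C g f"

locale abelian_length_category = abelian_category +
  assumes finite_length: "X \<in> Obj C \<Longrightarrow> finite_length C X"

text \<open>Subcategories are full, hence given by sets of objects. In the definitions below the ambient
  category \<open>C\<close> determines what kernels, cokernels and extensions are, so a torsion class in
  \<open>full_subcategory C W\<close> uses the intrinsic notions of \<open>W\<close>.\<close>

definition subcategory :: "('o, 'm) category \<Rightarrow> 'o set \<Rightarrow> bool" where
  "subcategory C S \<longleftrightarrow> S \<subseteq> Obj C \<and>
     (\<forall>X\<in>S. \<forall>Y\<in>Obj C. isomorphic C X Y \<longrightarrow> Y \<in> S) \<and>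
     (\<exists>Z\<in>S. zero_object C Z)"

definition extension_closed :: "('o, 'm) category \<Rightarrow> 'o set \<Rightarrow> bool" where
  "extension_closed C S \<longleftrightarrow>
     (\<forall>f g. short_exact C f g \<and> Dom C f \<in> S \<and> Cod C g \<in> S \<longrightarrow> Cod C f \<in> S)"

definition quotient_closed :: "('o, 'm) category \<Rightarrow> 'o set \<Rightarrow> bool" where
  "quotient_closed C S \<longleftrightarrow> (\<forall>f. epic C f \<and> Dom C f \<in> S \<longrightarrow> Cod C f \<in> S)"

definition subobject_closed :: "('o, 'm) category \<Rightarrow> 'o set \<Rightarrow> bool" where
  "subobject_closed C S \<longleftrightarrow> (\<forall>f. monic C f \<and> Cod C f \<in> S \<longrightarrow> Dom C f \<in> S)"

definition kernel_closed :: "('o, 'm) category \<Rightarrow> 'o set \<Rightarrow> bool" where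
  "kernel_closed C S \<longleftrightarrow>
     (\<forall>X\<in>S. \<forall>Y\<in>S. \<forall>f\<in>Hom C X Y. \<forall>k. is_kernel C f k \<longrightarrow> Dom C k \<in> S)"

definition cokernel_closed :: "('o, 'm) category \<Rightarrow> 'o set \<Rightarrow> bool" where
  "cokernel_closed C S \<longleftrightarrow>
     (\<forall>X\<in>S. \<forall>Y\<in>S. \<forall>f\<in>Hom C X Y. \<forall>c. is_cokernel C f c \<longrightarrow> Cod C c \<in> S)"

definition image_closed :: "('o, 'm) category \<Rightarrow> 'o set \<Rightarrow> bool" where
  "image_closed C S \<longleftrightarrow>
     (\<forall>X\<in>S. \<forall>Y\<in>S. \<forall>f\<in>Hom C X Y. \<forall>m. is_image C f m \<longrightarrow> Dom C m \<in> S)"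

definition torsion_class :: "('o, 'm) category \<Rightarrow> 'o set \<Rightarrow> bool" where
  "torsion_class C T \<longleftrightarrow> subcategory C T \<and> extension_closed C T \<and> quotient_closed C T"

definition torsion_free_class :: "('o, 'm) category \<Rightarrow> 'o set \<Rightarrow> bool" where
  "torsion_free_class C F \<longleftrightarrow> subcategory C F \<and> extension_closed C F \<and> subobject_closed C F"

definition torf :: "('o, 'm) category \<Rightarrow> 'o set set" where
  "torf C = {F. torsion_free_class C F}"

definition wide :: "('o, 'm) category \<Rightarrow> 'o set \<Rightarrow> bool" where
  "wide C S \<longleftrightarrow> subcategory C S \<and> extension_closed C S \<and> kernel_closed C S \<and> cokernel_closed C S"

definition ICE_closed :: "('o, 'm) category \<Rightarrow> 'o set \<Rightarrow> bool" where
  "ICE_closed C S \<longleftrightarrow> subcategory C S \<and> extension_closed C S \<and> image_closed C S \<and> cokernel_closed C S"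

definition left_perp :: "('o, 'm) category \<Rightarrow> 'o set \<Rightarrow> 'o set" where
  "left_perp C S = {M \<in> Obj C. \<forall>G\<in>S. Hom C M G = {Zero C M G}}"

definition right_perp :: "('o, 'm) category \<Rightarrow> 'o set \<Rightarrow> 'o set" where
  "right_perp C S = {M \<in> Obj C. \<forall>X\<in>S. Hom C X M = {Zero C X M}}"

text \<open>An interval \<open>[G, F]\<close> is represented by its end points.\<close>

definition torf_interval :: "('o, 'm) category \<Rightarrow> 'o set \<Rightarrow> 'o set \<Rightarrow> bool" where
  "torf_interval C G F \<longleftrightarrow> G \<in> torf C \<and> F \<in> torf C \<and> G \<subseteq> F"

definition heart :: "('o, 'm) category \<Rightarrow> 'o set \<Rightarrow> 'o set \<Rightarrow> 'o set" where
  "heart C G F = F \<inter> left_perp C G"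

definition wide_interval :: "('o, 'm) category \<Rightarrow> 'o set \<Rightarrow> 'o set \<Rightarrow> bool" where
  "wide_interval C G F \<longleftrightarrow> torf_interval C G F \<and> wide C (heart C G F)"

definition ICE_interval :: "('o, 'm) category \<Rightarrow> 'o set \<Rightarrow> 'o set \<Rightarrow> bool" where
  "ICE_interval C G F \<longleftrightarrow> torf_interval C G F \<and> ICE_closed C (heart C G F)"

definition W_R :: "('o, 'm) category \<Rightarrow> 'o set \<Rightarrow> 'o set" where
  "W_R C F = {X \<in> F. \<forall>Y\<in>F. \<forall>f\<in>Hom C X Y. \<forall>c. is_cokernel C f c \<longrightarrow> Cod C c \<in> F}"

text \<open>This is the first of the two expressions for \<open>F\<close> minus; the other one, the meet of \<open>F\<close> with
  all the targets of Hasse arrows starting at \<open>F\<close>, is a known consequence and not used here.\<close>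

definition torf_minus :: "('o, 'm) category \<Rightarrow> 'o set \<Rightarrow> 'o set" where
  "torf_minus C F = F \<inter> right_perp C (W_R C F)"

end

theory Submission
  imports Defs
begin

text \<open>
  Write \<open>\<^sup>\<bottom>G\<close> for \<open>left_perp C G\<close>, \<open>W\<close> for \<open>W_R C F\<close> and \<open>F\<^sup>-\<close> for \<open>torf_minus C F\<close>.

  Everything rests on two canonical short exact sequences, both obtained by extremal choices that
  finite length permits. First, a torsion-free class \<open>G\<close> gives every object \<open>M\<close> a torsion part in
  \<open>\<^sup>\<bottom>G\<close> with quotient in \<open>G\<close> (\<open>torsion_sequence\<close>). Second, every \<open>Y\<close> in \<open>F\<close> has a largest
  subobject in \<open>W\<close>, and the quotient is in \<open>F\<^sup>-\<close> (\<open>torf_minus_sequence\<close>). The second sequence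
  exists because \<open>W\<close> is closed under extensions and under those quotients that stay in \<open>F\<close>, and
  because \<open>Y/I\<close> is in \<open>F\<close> for every subobject \<open>I\<close> of \<open>Y\<close> in \<open>W\<close>. It shows that the heart of
  \<open>[F\<^sup>-, F]\<close> is exactly \<open>W\<close> (\<open>heart_torf_minus\<close>), which is wide (\<open>W_R_wide\<close>).

  So if \<open>F\<^sup>- \<subseteq> G\<close>, then \<open>F\<^sup>-\<close> is a choice of \<open>G'\<close>. If the heart of \<open>[G', F]\<close> is wide and
  \<open>G' \<subseteq> G\<close>, then the heart of \<open>[G, F]\<close> consists of those of its objects that lie in \<open>\<^sup>\<bottom>G\<close>. It is
  therefore a torsion class in it, and it inherits closure under images and cokernels. Finally, let
  the heart \<open>H\<close> of \<open>[G, F]\<close> be closed under cokernels. A morphism from an object of \<open>H\<close> to an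
  object \<open>Y\<close> of \<open>F\<close> lands in the torsion part of \<open>Y\<close>, which is in \<open>H\<close>. Hence its cokernel is an
  extension of an object of \<open>G\<close> by an object of \<open>H\<close> and lies in \<open>F\<close>; that is, \<open>H \<subseteq> W\<close>
  (\<open>heart_subset_W_R\<close>). The torsion part of an object of \<open>F\<^sup>-\<close> is in \<open>H \<subseteq> W\<close>, so it is zero, and
  \<open>F\<^sup>- \<subseteq> G\<close>.

  The needed facts about abelian categories are derived from the axioms by factoring through
  kernels and cokernels: the factorization of a morphism through its image
  (\<open>epic_monic_factorization\<close>), the third isomorphism theorem (\<open>third_isomorphism\<close>) and the
  pushout of a short exact sequence (\<open>pushout\<close>).
\<close>

section \<open>Composition and zero morphisms\<close>

context is_category
begin

lemma HomD:
  assumes "f \<in> Hom C X Y"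
  shows "f \<in> Arr C" "Dom C f = X" "Cod C f = Y" "X \<in> Obj C" "Y \<in> Obj C"
  using assms Dom_Obj[of f] Cod_Obj[of f] by (auto simp: Hom_def)

lemma Hom_iff: "f \<in> Hom C X Y \<longleftrightarrow> f \<in> Arr C \<and> Dom C f = X \<and> Cod C f = Y"
  by (simp add: Hom_def)

lemma monic_Hom:
  assumes "f \<in> Hom C X Y"
  shows "monic C f \<longleftrightarrow> (\<forall>W g h. g \<in> Hom C W X \<longrightarrow> h \<in> Hom C W X \<longrightarrow> f \<cdot> g = f \<cdot> h \<longrightarrow> g = h)"
  using HomD(1)[OF assms] HomD(4) unfolding monic_def HomD(2)[OF assms] by blast

lemma epic_Hom:
  assumes "f \<in> Hom C X Y"
  shows "epic C f \<longleftrightarrow> (\<forall>W g h. g \<in> Hom C Y W \<longrightarrow> h \<in> Hom C Y W \<longrightarrow> g \<cdot> f = h \<cdot> f \<longrightarrow> g = h)"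
  using HomD(1)[OF assms] HomD(5) unfolding epic_def HomD(3)[OF assms] by blast

lemma monic_cancel:
  assumes "monic C f" "f \<in> Hom C X Y" "g \<in> Hom C W X" "h \<in> Hom C W X" "f \<cdot> g = f \<cdot> h"
  shows "g = h"
  using assms(1)[unfolded monic_Hom[OF assms(2)]] assms(3-5) by blast

lemma epic_cancel:
  assumes "epic C f" "f \<in> Hom C X Y" "g \<in> Hom C Y W" "h \<in> Hom C Y W" "g \<cdot> f = h \<cdot> f"
  shows "g = h"
  using assms(1)[unfolded epic_Hom[OF assms(2)]] assms(3-5) by blast

lemma monic_Comp:
  assumes "monic C f" "monic C g" "f \<in> Hom C X Y" "g \<in> Hom C Y Z"
  shows "monic C (g \<cdot> f)"
proof -
  have "h = h'" if h: "h \<in> Hom C W X" "h' \<in> Hom C W X" "g \<cdot> f \<cdot> h = g \<cdot> f \<cdot> h'" for W h h'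
  proof -
    have "g \<cdot> (f \<cdot> h) = g \<cdot> (f \<cdot> h')"
      using h(3) Comp_assoc[OF h(1) assms(3,4)] Comp_assoc[OF h(2) assms(3,4)] by simp
    then have "f \<cdot> h = f \<cdot> h'"
      using monic_cancel[OF assms(2,4) Comp_Hom[OF h(1) assms(3)] Comp_Hom[OF h(2) assms(3)]] by simp
    then show ?thesis using monic_cancel[OF assms(1,3) h(1,2)] by simp
  qed
  then show ?thesis unfolding monic_Hom[OF Comp_Hom[OF assms(3,4)]] by blast
qed

lemma epic_Comp:
  assumes "epic C f" "epic C g" "f \<in> Hom C X Y" "g \<in> Hom C Y Z"
  shows "epic C (g \<cdot> f)"
proof -
  have "h = h'" if h: "h \<in> Hom C Z W" "h' \<in> Hom C Z W" "h \<cdot> (g \<cdot> f) = h' \<cdot> (g \<cdot> f)" for W h h'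
  proof -
    have "h \<cdot> g \<cdot> f = h' \<cdot> g \<cdot> f"
      using h(3) Comp_assoc[OF assms(3,4) h(1)] Comp_assoc[OF assms(3,4) h(2)] by simp
    then have "h \<cdot> g = h' \<cdot> g"
      using epic_cancel[OF assms(1,3) Comp_Hom[OF assms(4) h(1)] Comp_Hom[OF assms(4) h(2)]] by simp
    then show ?thesis using epic_cancel[OF assms(2,4) h(1,2)] by simp
  qed
  then show ?thesis unfolding epic_Hom[OF Comp_Hom[OF assms(3,4)]] by blast
qed

lemma monic_right_factor:
  assumes "monic C (g \<cdot> f)" "f \<in> Hom C X Y" "g \<in> Hom C Y Z"
  shows "monic C f"
proof -
  have "h = h'" if h: "h \<in> Hom C W X" "h' \<in> Hom C W X" "f \<cdot> h = f \<cdot> h'" for W h h'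
  proof -
    have "g \<cdot> f \<cdot> h = g \<cdot> f \<cdot> h'"
      using h(3) Comp_assoc[OF h(1) assms(2,3)] Comp_assoc[OF h(2) assms(2,3)] by simp
    then show ?thesis using monic_cancel[OF assms(1) Comp_Hom[OF assms(2,3)] h(1,2)] by simp
  qed
  then show ?thesis unfolding monic_Hom[OF assms(2)] by blast
qed

lemma epic_left_factor:
  assumes "epic C (g \<cdot> f)" "f \<in> Hom C X Y" "g \<in> Hom C Y Z"
  shows "epic C g"
proof -
  have "h = h'" if h: "h \<in> Hom C Z W" "h' \<in> Hom C Z W" "h \<cdot> g = h' \<cdot> g" for W h h'
  proof -
    have "h \<cdot> (g \<cdot> f) = h' \<cdot> (g \<cdot> f)"
      using h(3) Comp_assoc[OF assms(2,3) h(1)] Comp_assoc[OF assms(2,3) h(2)] by simp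
    then show ?thesis using epic_cancel[OF assms(1) Comp_Hom[OF assms(2,3)] h(1,2)] by simp
  qed
  then show ?thesis unfolding epic_Hom[OF assms(3)] by blast
qed

lemma monic_Ident:
  assumes "X \<in> Obj C"
  shows "monic C (Ident C X)"
  unfolding monic_Hom[OF Ident_Hom[OF assms]] by (simp add: Ident_Comp)

lemma epic_Ident:
  assumes "X \<in> Obj C"
  shows "epic C (Ident C X)"
  unfolding epic_Hom[OF Ident_Hom[OF assms]] by (simp add: Comp_Ident)

lemma is_iso_Hom:
  assumes "f \<in> Hom C X Y"
  shows "is_iso C f \<longleftrightarrow> (\<exists>g\<in>Hom C Y X. g \<cdot> f = Ident C X \<and> f \<cdot> g = Ident C Y)"
  unfolding is_iso_def HomD(2,3)[OF assms] using HomD(1)[OF assms] by simp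

lemma is_iso_inverse:
  assumes "is_iso C f" "f \<in> Hom C X Y"
  obtains g where "g \<in> Hom C Y X" "g \<cdot> f = Ident C X" "f \<cdot> g = Ident C Y" "is_iso C g"
proof -
  from assms obtain g where g: "g \<in> Hom C Y X" "g \<cdot> f = Ident C X" "f \<cdot> g = Ident C Y"
    using is_iso_Hom[OF assms(2)] by blast
  moreover have "is_iso C g" using is_iso_Hom[OF g(1)] g assms(2) by blast
  ultimately show thesis using that by blast
qed

lemma iso_monic:
  assumes "is_iso C f" "f \<in> Hom C X Y"
  shows "monic C f"
proof -
  obtain g where "g \<in> Hom C Y X" "g \<cdot> f = Ident C X"
    using is_iso_inverse[OF assms] .
  then show ?thesis
    using monic_right_factor[OF _ assms(2)] monic_Ident[OF HomD(4)[OF assms(2)]] by metis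
qed

lemma iso_epic:
  assumes "is_iso C f" "f \<in> Hom C X Y"
  shows "epic C f"
proof -
  obtain g where "g \<in> Hom C Y X" "f \<cdot> g = Ident C Y"
    using is_iso_inverse[OF assms] .
  then show ?thesis
    using epic_left_factor[OF _ _ assms(2)] epic_Ident[OF HomD(5)[OF assms(2)]] by metis
qed

end

context preadditive_category
begin

lemma Zero_Hom:
  assumes "X \<in> Obj C" "Y \<in> Obj C"
  shows "Zero C X Y \<in> Hom C X Y"
proof -
  interpret H: comm_group "hom_group C X Y" using Hom_comm_group[OF assms] .
  show ?thesis using H.one_closed by (simp add: hom_group_def)
qed

lemma hom_group_group:
  assumes "f \<in> Hom C X Y"
  shows "group (hom_group C X Y)"
  using comm_group.axioms(2)[OF Hom_comm_group] HomD(4,5)[OF assms] by blast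

lemma Add_Hom:
  assumes "f \<in> Hom C X Y" "g \<in> Hom C X Y"
  shows "f \<boxplus> g \<in> Hom C X Y"
proof -
  interpret H: group "hom_group C X Y" using hom_group_group[OF assms(1)] .
  show ?thesis using H.m_closed[of f g] assms by (simp add: hom_group_def)
qed

lemma Add_Zero:
  assumes "f \<in> Hom C X Y"
  shows "f \<boxplus> Zero C X Y = f"
proof -
  interpret H: group "hom_group C X Y" using hom_group_group[OF assms] .
  show ?thesis using H.r_one[of f] assms by (simp add: hom_group_def)
qed

lemma Zero_Add:
  assumes "f \<in> Hom C X Y"
  shows "Zero C X Y \<boxplus> f = f"
proof -
  interpret H: group "hom_group C X Y" using hom_group_group[OF assms] .
  show ?thesis using H.l_one[of f] assms by (simp add: hom_group_def)
qed

lemma negative_ex: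
  assumes "f \<in> Hom C X Y"
  shows "\<exists>g\<in>Hom C X Y. f \<boxplus> g = Zero C X Y"
proof -
  interpret H: group "hom_group C X Y" using hom_group_group[OF assms] .
  show ?thesis using H.r_inv_ex[of f] assms by (simp add: hom_group_def)
qed

lemma Add_right_cancel:
  assumes "f \<in> Hom C X Y" "g \<in> Hom C X Y" "h \<in> Hom C X Y" "f \<boxplus> h = g \<boxplus> h"
  shows "f = g"
proof -
  interpret H: group "hom_group C X Y" using hom_group_group[OF assms(1)] .
  have "f \<otimes>\<^bsub>hom_group C X Y\<^esub> h = g \<otimes>\<^bsub>hom_group C X Y\<^esub> h"
    using assms(4) by (simp add: hom_group_def)
  moreover have "f \<in> carrier (hom_group C X Y)" "g \<in> carrier (hom_group C X Y)"
    "h \<in> carrier (hom_group C X Y)" using assms by (simp_all add: hom_group_def)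
  ultimately show ?thesis using H.right_cancel by blast
qed

lemma Add_eq_self:
  assumes "f \<in> Hom C X Y" "g \<in> Hom C X Y" "g \<boxplus> f = f"
  shows "g = Zero C X Y"
  using Add_right_cancel[OF assms(2) Zero_Hom assms(1)] assms(3) Zero_Add[OF assms(1)]
    HomD(4,5)[OF assms(1)] by metis

lemma Zero_Comp:
  assumes "f \<in> Hom C X Y" "Z \<in> Obj C"
  shows "Zero C Y Z \<cdot> f = Zero C X Z"
proof -
  have z: "Zero C Y Z \<in> Hom C Y Z" using assms Zero_Hom HomD(5) by blast
  have "(Zero C Y Z \<cdot> f) \<boxplus> (Zero C Y Z \<cdot> f) = (Zero C Y Z \<boxplus> Zero C Y Z) \<cdot> f"
    using Comp_Add_left[OF assms(1) z z] by simp
  also have "\<dots> = Zero C Y Z \<cdot> f" using Add_Zero[OF z] by simp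
  finally show ?thesis using Add_eq_self Comp_Hom[OF assms(1) z] by blast
qed

lemma Comp_Zero:
  assumes "f \<in> Hom C X Y" "W \<in> Obj C"
  shows "f \<cdot> Zero C W X = Zero C W Y"
proof -
  have z: "Zero C W X \<in> Hom C W X" using assms Zero_Hom HomD(4) by blast
  have "(f \<cdot> Zero C W X) \<boxplus> (f \<cdot> Zero C W X) = f \<cdot> (Zero C W X \<boxplus> Zero C W X)"
    using Comp_Add_right[OF z z assms(1)] by simp
  also have "\<dots> = f \<cdot> Zero C W X" using Add_Zero[OF z] by simp
  finally show ?thesis using Add_eq_self Comp_Hom[OF z assms(1)] by blast
qed

text \<open>Subtracting two competing factorizations reduces cancellation to the case of zero.\<close>

lemma monicI:
  assumes f: "f \<in> Hom C X Y"
    and zero: "\<And>W g. g \<in> Hom C W X \<Longrightarrow> f \<cdot> g = Zero C W Y \<Longrightarrow> g = Zero C W X"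
  shows "monic C f"
proof -
  have "g = h" if g: "g \<in> Hom C W X" and h: "h \<in> Hom C W X" and eq: "f \<cdot> g = f \<cdot> h" for W g h
  proof -
    obtain h' where h': "h' \<in> Hom C W X" "h \<boxplus> h' = Zero C W X" using negative_ex[OF h] by blast
    have "f \<cdot> (g \<boxplus> h') = (f \<cdot> g) \<boxplus> (f \<cdot> h')" using Comp_Add_right[OF g h'(1) f] .
    also have "\<dots> = f \<cdot> (h \<boxplus> h')" using Comp_Add_right[OF h h'(1) f] eq by simp
    also have "\<dots> = Zero C W Y" using h'(2) Comp_Zero[OF f] HomD(4)[OF g] by simp
    finally have "g \<boxplus> h' = h \<boxplus> h'" using zero[OF Add_Hom[OF g h'(1)]] h'(2) by simp
    then show ?thesis using Add_right_cancel g h h'(1) by blast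
  qed
  then show ?thesis unfolding monic_Hom[OF f] by blast
qed

lemma epicI:
  assumes f: "f \<in> Hom C X Y"
    and zero: "\<And>W g. g \<in> Hom C Y W \<Longrightarrow> g \<cdot> f = Zero C X W \<Longrightarrow> g = Zero C Y W"
  shows "epic C f"
proof -
  have "g = h" if g: "g \<in> Hom C Y W" and h: "h \<in> Hom C Y W" and eq: "g \<cdot> f = h \<cdot> f" for W g h
  proof -
    obtain h' where h': "h' \<in> Hom C Y W" "h \<boxplus> h' = Zero C Y W" using negative_ex[OF h] by blast
    have "(g \<boxplus> h') \<cdot> f = (g \<cdot> f) \<boxplus> (h' \<cdot> f)" using Comp_Add_left[OF f g h'(1)] .
    also have "\<dots> = (h \<boxplus> h') \<cdot> f" using Comp_Add_left[OF f h h'(1)] eq by simp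
    also have "\<dots> = Zero C X W" using h'(2) Zero_Comp[OF f] HomD(5)[OF g] by simp
    finally have "g \<boxplus> h' = h \<boxplus> h'" using zero[OF Add_Hom[OF g h'(1)]] h'(2) by simp
    then show ?thesis using Add_right_cancel g h h'(1) by blast
  qed
  then show ?thesis unfolding epic_Hom[OF f] by blast
qed

lemma monic_zero:
  assumes "monic C f" "f \<in> Hom C X Y" "g \<in> Hom C W X" "f \<cdot> g = Zero C W Y"
  shows "g = Zero C W X"
  using monic_cancel[OF assms(1-3) Zero_Hom] Comp_Zero[OF assms(2)] assms(4) HomD[OF assms(3)]
  by metis

lemma epic_zero:
  assumes "epic C f" "f \<in> Hom C X Y" "g \<in> Hom C Y W" "g \<cdot> f = Zero C X W"
  shows "g = Zero C Y W"
  using epic_cancel[OF assms(1-3) Zero_Hom] Zero_Comp[OF assms(2)] assms(4) HomD[OF assms(3)]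
  by metis

section \<open>Kernels, cokernels and short exact sequences\<close>

lemma is_kernelD:
  assumes "is_kernel C f k"
  shows "f \<in> Arr C" "k \<in> Arr C" "Cod C k = Dom C f" "f \<cdot> k = Zero C (Dom C k) (Cod C f)"
  using assms unfolding is_kernel_def by blast+

lemma is_cokernelD:
  assumes "is_cokernel C f c"
  shows "f \<in> Arr C" "c \<in> Arr C" "Dom C c = Cod C f" "c \<cdot> f = Zero C (Dom C f) (Cod C c)"
  using assms unfolding is_cokernel_def by blast+

lemma kernel_zero: "is_kernel C f k \<Longrightarrow> f \<in> Hom C X Y \<Longrightarrow> k \<in> Hom C K X \<Longrightarrow> f \<cdot> k = Zero C K Y"
  using is_kernelD(4) by (simp add: Hom_iff)

lemma cokernel_zero:
  "is_cokernel C f c \<Longrightarrow> f \<in> Hom C X Y \<Longrightarrow> c \<in> Hom C Y Q \<Longrightarrow> c \<cdot> f = Zero C X Q"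
  using is_cokernelD(4) by (simp add: Hom_iff)

lemma kernel_Hom: "is_kernel C f k \<Longrightarrow> f \<in> Hom C X Y \<Longrightarrow> k \<in> Hom C (Dom C k) X"
  using is_kernelD by (simp add: Hom_iff)

lemma cokernel_Hom: "is_cokernel C f c \<Longrightarrow> f \<in> Hom C X Y \<Longrightarrow> c \<in> Hom C Y (Cod C c)"
  using is_cokernelD by (simp add: Hom_iff)

lemma kernel_of_Hom:
  assumes "is_kernel C f k" "k \<in> Hom C K X"
  obtains Y where "f \<in> Hom C X Y"
  using is_kernelD[OF assms(1)] assms(2) that by (simp add: Hom_iff)

lemma cokernel_of_Hom:
  assumes "is_cokernel C f c" "c \<in> Hom C Y Q"
  obtains X where "f \<in> Hom C X Y"
  using is_cokernelD[OF assms(1)] assms(2) that by (simp add: Hom_iff)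

lemma is_kernelE:
  assumes "is_kernel C f k"
  obtains X Y K where "f \<in> Hom C X Y" "k \<in> Hom C K X"
  using is_kernelD[OF assms] that by (simp add: Hom_iff)

lemma is_cokernelE:
  assumes "is_cokernel C f c"
  obtains X Y Q where "f \<in> Hom C X Y" "c \<in> Hom C Y Q"
  using is_cokernelD[OF assms] that by (simp add: Hom_iff)

lemma kernel_factor:
  assumes "is_kernel C f k" "f \<in> Hom C X Y" "k \<in> Hom C K X" "h \<in> Hom C W X" "f \<cdot> h = Zero C W Y"
  obtains u where "u \<in> Hom C W K" "k \<cdot> u = h"
proof -
  have "h \<in> Arr C" "Cod C h = Dom C f \<and> f \<cdot> h = Zero C (Dom C h) (Cod C f)"
    using assms by (auto simp: Hom_iff)
  then obtain u where "u \<in> Hom C (Dom C h) (Dom C k)" "k \<cdot> u = h"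
    using assms(1) unfolding is_kernel_def by blast
  then show thesis using that assms by (simp add: Hom_iff)
qed

lemma cokernel_factor:
  assumes "is_cokernel C f c" "f \<in> Hom C X Y" "c \<in> Hom C Y Q" "h \<in> Hom C Y W" "h \<cdot> f = Zero C X W"
  obtains u where "u \<in> Hom C Q W" "u \<cdot> c = h"
proof -
  have "h \<in> Arr C" "Dom C h = Cod C f \<and> h \<cdot> f = Zero C (Dom C f) (Cod C h)"
    using assms by (auto simp: Hom_iff)
  then obtain u where "u \<in> Hom C (Cod C c) (Cod C h)" "u \<cdot> c = h"
    using assms(1) unfolding is_cokernel_def by blast
  then show thesis using that assms by (simp add: Hom_iff)
qed

lemma kernel_monic:
  assumes "is_kernel C f k"
  shows "monic C k"
proof -
  obtain X Y K where f: "f \<in> Hom C X Y" and k: "k \<in> Hom C K X"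
    using is_kernelE[OF assms] .
  have "g = h" if g: "g \<in> Hom C W K" "h \<in> Hom C W K" "k \<cdot> g = k \<cdot> h" for W g h
  proof -
    have kg: "k \<cdot> g \<in> Hom C W X" using Comp_Hom[OF g(1) k] .
    have "f \<cdot> (k \<cdot> g) = Zero C W Y"
      using Comp_assoc[OF g(1) k f] kernel_zero[OF assms f k] Zero_Comp[OF g(1)] HomD(5)[OF f] by simp
    then have "k \<cdot> g \<in> Arr C"
      "Cod C (k \<cdot> g) = Dom C f \<and> f \<cdot> (k \<cdot> g) = Zero C (Dom C (k \<cdot> g)) (Cod C f)"
      using HomD[OF kg] HomD[OF f] by auto
    then have "\<exists>!u. u \<in> Hom C (Dom C (k \<cdot> g)) (Dom C k) \<and> k \<cdot> u = k \<cdot> g"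
      using assms unfolding is_kernel_def by blast
    then have "\<exists>!u. u \<in> Hom C W K \<and> k \<cdot> u = k \<cdot> g"
      using HomD(2)[OF kg] HomD(2)[OF k] by simp
    then show ?thesis using g by metis
  qed
  then show ?thesis unfolding monic_Hom[OF k] by blast
qed

lemma cokernel_epic:
  assumes "is_cokernel C f c"
  shows "epic C c"
proof -
  obtain X Y Q where f: "f \<in> Hom C X Y" and c: "c \<in> Hom C Y Q"
    using is_cokernelE[OF assms] .
  have "g = h" if g: "g \<in> Hom C Q W" "h \<in> Hom C Q W" "g \<cdot> c = h \<cdot> c" for W g h
  proof -
    have gc: "g \<cdot> c \<in> Hom C Y W" using Comp_Hom[OF c g(1)] .
    have "g \<cdot> c \<cdot> f = Zero C X W"
      using Comp_assoc[OF f c g(1)] cokernel_zero[OF assms f c] Comp_Zero[OF g(1)] HomD(4)[OF f] by simp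
    then have "g \<cdot> c \<in> Arr C"
      "Dom C (g \<cdot> c) = Cod C f \<and> g \<cdot> c \<cdot> f = Zero C (Dom C f) (Cod C (g \<cdot> c))"
      using HomD[OF gc] HomD[OF f] by auto
    then have "\<exists>!u. u \<in> Hom C (Cod C c) (Cod C (g \<cdot> c)) \<and> u \<cdot> c = g \<cdot> c"
      using assms unfolding is_cokernel_def by blast
    then have "\<exists>!u. u \<in> Hom C Q W \<and> u \<cdot> c = g \<cdot> c"
      using HomD(3)[OF gc] HomD(3)[OF c] by simp
    then show ?thesis using g by metis
  qed
  then show ?thesis unfolding epic_Hom[OF c] by blast
qed

lemma is_kernelI:
  assumes f: "f \<in> Hom C X Y" and k: "k \<in> Hom C K X" and "f \<cdot> k = Zero C K Y" and "monic C k"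
    and factor: "\<And>W h. h \<in> Hom C W X \<Longrightarrow> f \<cdot> h = Zero C W Y \<Longrightarrow> \<exists>u\<in>Hom C W K. k \<cdot> u = h"
  shows "is_kernel C f k"
proof -
  have "\<exists>!u. u \<in> Hom C (Dom C h) K \<and> k \<cdot> u = h"
    if h: "h \<in> Arr C" "Cod C h = X" "f \<cdot> h = Zero C (Dom C h) Y" for h
  proof -
    obtain u where "u \<in> Hom C (Dom C h) K" "k \<cdot> u = h"
      using factor[of h "Dom C h"] h by (auto simp: Hom_iff)
    then show ?thesis using monic_cancel[OF assms(4) k] by metis
  qed
  then show ?thesis using assms(1-3) unfolding is_kernel_def Hom_iff by blast
qed

lemma is_cokernelI:
  assumes f: "f \<in> Hom C X Y" and c: "c \<in> Hom C Y Q" and "c \<cdot> f = Zero C X Q" and "epic C c"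
    and factor: "\<And>W h. h \<in> Hom C Y W \<Longrightarrow> h \<cdot> f = Zero C X W \<Longrightarrow> \<exists>u\<in>Hom C Q W. u \<cdot> c = h"
  shows "is_cokernel C f c"
proof -
  have "\<exists>!u. u \<in> Hom C Q (Cod C h) \<and> u \<cdot> c = h"
    if h: "h \<in> Arr C" "Dom C h = Y" "h \<cdot> f = Zero C X (Cod C h)" for h
  proof -
    obtain u where "u \<in> Hom C Q (Cod C h)" "u \<cdot> c = h"
      using factor[of h "Cod C h"] h by (auto simp: Hom_iff)
    then show ?thesis using epic_cancel[OF assms(4) c] by metis
  qed
  then show ?thesis using assms(1-3) unfolding is_cokernel_def Hom_iff by blast
qed

lemma kernel_isomorphic:
  assumes k: "is_kernel C f k" "k \<in> Hom C K X" and k': "is_kernel C f k'" "k' \<in> Hom C K' X"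
  shows "isomorphic C K K'"
proof -
  obtain Y where f: "f \<in> Hom C X Y" using kernel_of_Hom[OF k] .
  obtain u where u: "u \<in> Hom C K K'" "k' \<cdot> u = k"
    using kernel_factor[OF k'(1) f k'(2) k(2) kernel_zero[OF k(1) f k(2)]] .
  obtain v where v: "v \<in> Hom C K' K" "k \<cdot> v = k'"
    using kernel_factor[OF k(1) f k(2) k'(2) kernel_zero[OF k'(1) f k'(2)]] .
  have "k \<cdot> (v \<cdot> u) = k \<cdot> Ident C K"
    using Comp_assoc[OF u(1) v(1) k(2)] u v Comp_Ident[OF k(2)] by simp
  then have 1: "v \<cdot> u = Ident C K"
    using monic_cancel[OF kernel_monic[OF k(1)] k(2) Comp_Hom[OF u(1) v(1)] Ident_Hom] HomD(4)[OF u(1)]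
    by blast
  have "k' \<cdot> (u \<cdot> v) = k' \<cdot> Ident C K'"
    using Comp_assoc[OF v(1) u(1) k'(2)] u v Comp_Ident[OF k'(2)] by simp
  then have "u \<cdot> v = Ident C K'"
    using monic_cancel[OF kernel_monic[OF k'(1)] k'(2) Comp_Hom[OF v(1) u(1)] Ident_Hom] HomD(4)[OF v(1)]
    by blast
  then show ?thesis
    using 1 u(1) v(1) is_iso_Hom[OF u(1)] unfolding isomorphic_def by blast
qed

lemma cokernel_isomorphic:
  assumes c: "is_cokernel C f c" "c \<in> Hom C Y Q" and c': "is_cokernel C f c'" "c' \<in> Hom C Y Q'"
  shows "isomorphic C Q Q'"
proof -
  obtain X where f: "f \<in> Hom C X Y" using cokernel_of_Hom[OF c] .
  obtain u where u: "u \<in> Hom C Q Q'" "u \<cdot> c = c'"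
    using cokernel_factor[OF c(1) f c(2) c'(2) cokernel_zero[OF c'(1) f c'(2)]] .
  obtain v where v: "v \<in> Hom C Q' Q" "v \<cdot> c' = c"
    using cokernel_factor[OF c'(1) f c'(2) c(2) cokernel_zero[OF c(1) f c(2)]] .
  have "v \<cdot> u \<cdot> c = Ident C Q \<cdot> c"
    using Comp_assoc[OF c(2) u(1) v(1)] u v Ident_Comp[OF c(2)] by simp
  then have 1: "v \<cdot> u = Ident C Q"
    using epic_cancel[OF cokernel_epic[OF c(1)] c(2) Comp_Hom[OF u(1) v(1)] Ident_Hom] HomD(4)[OF u(1)]
    by blast
  have "u \<cdot> v \<cdot> c' = Ident C Q' \<cdot> c'"
    using Comp_assoc[OF c'(2) v(1) u(1)] u v Ident_Comp[OF c'(2)] by simp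
  then have "u \<cdot> v = Ident C Q'"
    using epic_cancel[OF cokernel_epic[OF c'(1)] c'(2) Comp_Hom[OF v(1) u(1)] Ident_Hom] HomD(4)[OF v(1)]
    by blast
  then show ?thesis
    using 1 u(1) v(1) is_iso_Hom[OF u(1)] unfolding isomorphic_def by blast
qed

lemma zero_object_Hom:
  assumes "zero_object C Z"
  shows "f \<in> Hom C X Z \<Longrightarrow> f = Zero C X Z" "f \<in> Hom C Z X \<Longrightarrow> f = Zero C Z X"
  using assms Zero_Hom HomD unfolding zero_object_def by metis+

lemma isomorphic_zero_objects:
  assumes "zero_object C Z" "zero_object C Z'"
  shows "isomorphic C Z Z'"
proof -
  have o: "Z \<in> Obj C" "Z' \<in> Obj C" using assms by (auto simp: zero_object_def)
  then obtain f g where fg: "f \<in> Hom C Z Z'" "g \<in> Hom C Z' Z" using Zero_Hom by meson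
  have "g \<cdot> f = Ident C Z"
    using zero_object_Hom(2)[OF assms(1)] Comp_Hom fg Ident_Hom[OF o(1)] by metis
  moreover have "f \<cdot> g = Ident C Z'"
    using zero_object_Hom(2)[OF assms(2)] Comp_Hom fg Ident_Hom[OF o(2)] by metis
  ultimately show ?thesis using is_iso_Hom[OF fg(1)] fg unfolding isomorphic_def by blast
qed

end

context abelian_category
begin

lemma kernelE:
  assumes "f \<in> Hom C X Y"
  obtains K k where "is_kernel C f k" "k \<in> Hom C K X"
  using kernel_ex kernel_Hom assms HomD(1) by metis

lemma cokernelE:
  assumes "f \<in> Hom C X Y"
  obtains Q c where "is_cokernel C f c" "c \<in> Hom C Y Q"
  using cokernel_ex cokernel_Hom assms HomD(1) by metis

text \<open>Every monomorphism is the kernel of some \<open>g\<close>; since \<open>g\<close> factors through the cokernel \<open>c\<close>,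
  whatever \<open>c\<close> kills is killed by \<open>g\<close> too.\<close>

lemma monic_short_exact:
  assumes "monic C f" "is_cokernel C f c"
  shows "short_exact C f c"
proof -
  obtain X Y Q where f: "f \<in> Hom C X Y" and c: "c \<in> Hom C Y Q"
    using is_cokernelE[OF assms(2)] .
  obtain g where g: "is_kernel C g f" using monic_normal[OF assms(1)] by blast
  then obtain Z where gH: "g \<in> Hom C Y Z" using kernel_of_Hom f by blast
  obtain u where u: "u \<in> Hom C Q Z" "u \<cdot> c = g"
    using cokernel_factor[OF assms(2) f c gH kernel_zero[OF g gH f]] .
  have "is_kernel C c f"
  proof (rule is_kernelI[OF c f cokernel_zero[OF assms(2) f c] assms(1)])
    fix W h assume h: "h \<in> Hom C W Y" "c \<cdot> h = Zero C W Q"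
    have "g \<cdot> h = Zero C W Z"
      using Comp_assoc[OF h(1) c u(1)] u(2) h(2) Comp_Zero[OF u(1)] HomD(4)[OF h(1)] by simp
    then show "\<exists>u\<in>Hom C W X. f \<cdot> u = h" using kernel_factor[OF g gH f h(1)] by metis
  qed
  then show ?thesis using assms(2) unfolding short_exact_def by blast
qed

lemma epic_short_exact:
  assumes "epic C f" "is_kernel C f k"
  shows "short_exact C k f"
proof -
  obtain X Y K where f: "f \<in> Hom C X Y" and k: "k \<in> Hom C K X"
    using is_kernelE[OF assms(2)] .
  obtain g where g: "is_cokernel C g f" using epic_normal[OF assms(1)] by blast
  then obtain Z where gH: "g \<in> Hom C Z X" using cokernel_of_Hom f by blast
  obtain u where u: "u \<in> Hom C Z K" "k \<cdot> u = g"
    using kernel_factor[OF assms(2) f k gH cokernel_zero[OF g gH f]] .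
  have "is_cokernel C k f"
  proof (rule is_cokernelI[OF k f kernel_zero[OF assms(2) f k] assms(1)])
    fix W h assume h: "h \<in> Hom C X W" "h \<cdot> k = Zero C K W"
    have "h \<cdot> g = Zero C Z W"
      using Comp_assoc[OF u(1) k h(1)] u(2) h(2) Zero_Comp[OF u(1)] HomD(5)[OF h(1)] by simp
    then show "\<exists>u\<in>Hom C Y W. u \<cdot> f = h" using cokernel_factor[OF g gH f h(1)] by metis
  qed
  then show ?thesis using assms(2) unfolding short_exact_def by blast
qed

lemma monic_epic_iso:
  assumes "monic C f" "epic C f" "f \<in> Hom C X Y"
  shows "is_iso C f"
proof -
  obtain g where g: "is_kernel C g f" using monic_normal[OF assms(1)] by blast
  then obtain Z where gH: "g \<in> Hom C Y Z" using kernel_of_Hom assms(3) by blast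
  have o: "X \<in> Obj C" "Y \<in> Obj C" using HomD(4,5)[OF assms(3)] .
  have "g = Zero C Y Z" using epic_zero[OF assms(2,3) gH kernel_zero[OF g gH assms(3)]] .
  then have "g \<cdot> Ident C Y = Zero C Y Z" using Comp_Ident[OF gH] by simp
  then obtain u where u: "u \<in> Hom C Y X" "f \<cdot> u = Ident C Y"
    using kernel_factor[OF g gH assms(3) Ident_Hom[OF o(2)]] by metis
  have "f \<cdot> (u \<cdot> f) = f \<cdot> Ident C X"
    using Comp_assoc[OF assms(3) u(1) assms(3)] u(2) Ident_Comp[OF assms(3)] Comp_Ident[OF assms(3)]
    by simp
  then have "u \<cdot> f = Ident C X"
    using monic_cancel[OF assms(1,3) Comp_Hom[OF assms(3) u(1)] Ident_Hom[OF o(1)]] by simp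
  then show ?thesis using is_iso_Hom[OF assms(3)] u by blast
qed

text \<open>The image \<open>m\<close> of \<open>f\<close> is the kernel of the cokernel \<open>c\<close> of \<open>f\<close>. If \<open>g\<close> kills the first factor
  \<open>e\<close>, then \<open>f\<close> already factors through the smaller subobject \<open>m \<cdot> k\<close>, where \<open>k\<close> is the kernel of
  \<open>g\<close>. That subobject is itself a kernel of a morphism vanishing on \<open>f\<close>, hence of one factoring
  through \<open>c\<close>; so it contains \<open>m\<close> and \<open>g\<close> is zero.\<close>

lemma image_factorization:
  assumes f: "f \<in> Hom C X Y" and im: "is_image C f m" and m: "m \<in> Hom C I Y"
  obtains e where "epic C e" "e \<in> Hom C X I" "monic C m" "m \<cdot> e = f"
proof -
  obtain c where c: "is_cokernel C f c" "is_kernel C c m" using im unfolding is_image_def by blast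
  then obtain Q where cH: "c \<in> Hom C Y Q" using cokernel_Hom[OF c(1) f] by blast
  obtain e where e: "e \<in> Hom C X I" "m \<cdot> e = f"
    using kernel_factor[OF c(2) cH m f cokernel_zero[OF c(1) f cH]] .
  have mm: "monic C m" using kernel_monic[OF c(2)] .
  have "epic C e"
  proof (rule epicI[OF e(1)])
    fix W g assume g: "g \<in> Hom C I W" "g \<cdot> e = Zero C X W"
    obtain K k where k: "is_kernel C g k" "k \<in> Hom C K I" using kernelE[OF g(1)] .
    obtain e' where e': "e' \<in> Hom C X K" "k \<cdot> e' = e"
      using kernel_factor[OF k(1) g(1) k(2) e(1) g(2)] .
    have mk: "m \<cdot> k \<in> Hom C K Y" using Comp_Hom[OF k(2) m] .
    have "monic C (m \<cdot> k)" using monic_Comp[OF kernel_monic[OF k(1)] mm k(2) m] .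
    then obtain d where d: "is_kernel C d (m \<cdot> k)" using monic_normal by blast
    then obtain Z where dH: "d \<in> Hom C Y Z" using kernel_of_Hom mk by blast
    have "f = m \<cdot> k \<cdot> e'" using Comp_assoc[OF e'(1) k(2) m] e' e by simp
    then have "d \<cdot> f = d \<cdot> (m \<cdot> k) \<cdot> e'" using Comp_assoc[OF e'(1) mk dH] by simp
    also have "\<dots> = Zero C X Z"
      using kernel_zero[OF d dH mk] Zero_Comp[OF e'(1)] HomD(5)[OF dH] by simp
    finally obtain d' where d': "d' \<in> Hom C Q Z" "d' \<cdot> c = d"
      using cokernel_factor[OF c(1) f cH dH] by metis
    have "d \<cdot> m = Zero C I Z"
      using Comp_assoc[OF m cH d'(1)] d'(2) kernel_zero[OF c(2) cH m] Comp_Zero[OF d'(1)] HomD(4)[OF m]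
      by simp
    then obtain v where v: "v \<in> Hom C I K" "m \<cdot> k \<cdot> v = m"
      using kernel_factor[OF d dH mk m] by metis
    have "m \<cdot> (k \<cdot> v) = m \<cdot> Ident C I" using Comp_assoc[OF v(1) k(2) m] v(2) Comp_Ident[OF m] by simp
    then have kv: "k \<cdot> v = Ident C I"
      using monic_cancel[OF mm m Comp_Hom[OF v(1) k(2)] Ident_Hom] HomD(4)[OF m] by blast
    have "g = g \<cdot> k \<cdot> v" using Comp_assoc[OF v(1) k(2) g(1)] kv Comp_Ident[OF g(1)] by simp
    also have "\<dots> = Zero C I W"
      using kernel_zero[OF k(1) g(1) k(2)] Zero_Comp[OF v(1)] HomD(5)[OF g(1)] by simp
    finally show "g = Zero C I W" .
  qed
  then show thesis using that e mm by blast
qed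

lemma epic_monic_factorization:
  assumes f: "f \<in> Hom C X Y"
  obtains I e m where "epic C e" "e \<in> Hom C X I" "monic C m" "m \<in> Hom C I Y" "m \<cdot> e = f"
proof -
  obtain Q c where c: "is_cokernel C f c" "c \<in> Hom C Y Q" using cokernelE[OF f] .
  obtain I m where m: "is_kernel C c m" "m \<in> Hom C I Y" using kernelE[OF c(2)] .
  have "is_image C f m" using c(1) m(1) unfolding is_image_def by blast
  then show thesis using that image_factorization[OF f _ m(2)] m(2) by metis
qed

lemma cokernel_epic_Comp:
  assumes e: "epic C e" "e \<in> Hom C X I" and m: "m \<in> Hom C I Y"
  shows "is_cokernel C (m \<cdot> e) c \<longleftrightarrow> is_cokernel C m c"
proof -
  have me: "m \<cdot> e \<in> Hom C X Y" using Comp_Hom[OF e(2) m] .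
  have z: "h \<cdot> (m \<cdot> e) = Zero C X W \<longleftrightarrow> h \<cdot> m = Zero C I W" if h: "h \<in> Hom C Y W" for h W
  proof
    assume "h \<cdot> (m \<cdot> e) = Zero C X W"
    then show "h \<cdot> m = Zero C I W"
      using epic_zero[OF e Comp_Hom[OF m h]] Comp_assoc[OF e(2) m h] by simp
  next
    assume "h \<cdot> m = Zero C I W"
    then show "h \<cdot> (m \<cdot> e) = Zero C X W"
      using Comp_assoc[OF e(2) m h] Zero_Comp[OF e(2)] HomD(5)[OF h] by simp
  qed
  show ?thesis
  proof
    assume c: "is_cokernel C (m \<cdot> e) c"
    then obtain Q where cH: "c \<in> Hom C Y Q" using cokernel_Hom[OF c me] by blast
    show "is_cokernel C m c"
    proof (rule is_cokernelI[OF m cH _ cokernel_epic[OF c]])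
      show "c \<cdot> m = Zero C I Q" using z[OF cH] cokernel_zero[OF c me cH] by simp
      fix W h assume h: "h \<in> Hom C Y W" "h \<cdot> m = Zero C I W"
      show "\<exists>u\<in>Hom C Q W. u \<cdot> c = h" using cokernel_factor[OF c me cH h(1)] z[OF h(1)] h(2) by metis
    qed
  next
    assume c: "is_cokernel C m c"
    then obtain Q where cH: "c \<in> Hom C Y Q" using cokernel_Hom[OF c m] by blast
    show "is_cokernel C (m \<cdot> e) c"
    proof (rule is_cokernelI[OF me cH _ cokernel_epic[OF c]])
      show "c \<cdot> (m \<cdot> e) = Zero C X Q" using z[OF cH] cokernel_zero[OF c m cH] by simp
      fix W h assume h: "h \<in> Hom C Y W" "h \<cdot> (m \<cdot> e) = Zero C X W"
      show "\<exists>u\<in>Hom C Q W. u \<cdot> c = h" using cokernel_factor[OF c m cH h(1)] z[OF h(1)] h(2) by metis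
    qed
  qed
qed

text \<open>The sequence \<open>0 \<rightarrow> T/X \<rightarrow> Y/X \<rightarrow> Y/T \<rightarrow> 0\<close> for a subobject \<open>T\<close> of \<open>Y\<close> and a morphism \<open>X \<rightarrow> T\<close>,
  where \<open>/X\<close> denotes division by the image of \<open>X\<close>. The nontrivial point is that \<open>j\<close> is monic.
  Its first factor \<open>e\<close> is, because \<open>c'\<close> and \<open>e \<cdot> c'\<close> have the same kernel, namely the image of \<open>X\<close>.\<close>

lemma third_isomorphism:
  assumes f: "f \<in> Hom C X T" and t: "t \<in> Hom C T Y"
    and se: "short_exact C t p" and p: "p \<in> Hom C Y P"
    and c': "is_cokernel C f c'" "c' \<in> Hom C T D"
    and c: "is_cokernel C (t \<cdot> f) c" "c \<in> Hom C Y E"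
  obtains j p' where "j \<in> Hom C D E" "p' \<in> Hom C E P" "j \<cdot> c' = c \<cdot> t" "p' \<cdot> c = p"
    "short_exact C j p'"
proof -
  have pt: "is_kernel C p t" "is_cokernel C t p" using se by (auto simp: short_exact_def)
  have tm: "monic C t" using kernel_monic[OF pt(1)] .
  have ec: "epic C c" and ec': "epic C c'" and ep: "epic C p"
    using cokernel_epic c(1) c'(1) pt(2) by blast+
  have tf: "t \<cdot> f \<in> Hom C X Y" using Comp_Hom[OF f t] .
  have ct: "c \<cdot> t \<in> Hom C T E" using Comp_Hom[OF t c(2)] .
  have "c \<cdot> t \<cdot> f = Zero C X E"
    using Comp_assoc[OF f t c(2)] cokernel_zero[OF c(1) tf c(2)] by simp
  then obtain j where j: "j \<in> Hom C D E" "j \<cdot> c' = c \<cdot> t"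
    using cokernel_factor[OF c'(1) f c'(2) ct] by metis
  have pt0: "p \<cdot> t = Zero C T P" using kernel_zero[OF pt(1) p t] .
  then have "p \<cdot> (t \<cdot> f) = Zero C X P"
    using Comp_assoc[OF f t p] Zero_Comp[OF f] HomD(5)[OF p] by simp
  then obtain p' where p': "p' \<in> Hom C E P" "p' \<cdot> c = p"
    using cokernel_factor[OF c(1) tf c(2) p] by metis
  have ep': "epic C p'" using epic_left_factor[OF _ c(2) p'(1)] p'(2) ep by simp
  have "p' \<cdot> j \<cdot> c' = p' \<cdot> c \<cdot> t"
    using Comp_assoc[OF c'(2) j(1) p'(1)] j(2) Comp_assoc[OF t c(2) p'(1)] by simp
  then have "p' \<cdot> j \<cdot> c' = Zero C T P" using p'(2) pt0 by simp
  then have pj: "p' \<cdot> j = Zero C D P"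
    using epic_zero[OF ec' c'(2) Comp_Hom[OF j(1) p'(1)]] by simp
  have cok: "is_cokernel C j p'"
  proof (rule is_cokernelI[OF j(1) p'(1) pj ep'])
    fix W u assume u: "u \<in> Hom C E W" "u \<cdot> j = Zero C D W"
    have "u \<cdot> c \<cdot> t = u \<cdot> j \<cdot> c'"
      using Comp_assoc[OF t c(2) u(1)] Comp_assoc[OF c'(2) j(1) u(1)] j(2) by simp
    then have "u \<cdot> c \<cdot> t = Zero C T W" using u(2) Zero_Comp[OF c'(2)] HomD(5)[OF u(1)] by simp
    then obtain v where v: "v \<in> Hom C P W" "v \<cdot> p = u \<cdot> c"
      using cokernel_factor[OF pt(2) t p Comp_Hom[OF c(2) u(1)]] by metis
    have "v \<cdot> p' \<cdot> c = u \<cdot> c" using Comp_assoc[OF c(2) p'(1) v(1)] v(2) p'(2) by simp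
    then have "v \<cdot> p' = u" using epic_cancel[OF ec c(2) Comp_Hom[OF p'(1) v(1)] u(1)] by simp
    then show "\<exists>v\<in>Hom C P W. v \<cdot> p' = u" using v(1) by blast
  qed
  obtain I e m where em: "epic C e" "e \<in> Hom C D I" "monic C m" "m \<in> Hom C I E" "m \<cdot> e = j"
    using epic_monic_factorization[OF j(1)] .
  have ec'H: "e \<cdot> c' \<in> Hom C T I" using Comp_Hom[OF c'(2) em(2)] .
  \<comment> \<open>Comparing kernels: \<open>c'\<close> kills the kernel \<open>k\<close> of \<open>e \<cdot> c'\<close>, so \<open>c'\<close> factors through \<open>e \<cdot> c'\<close> and
    \<open>e\<close> has a left inverse.\<close>
  obtain K k where k: "is_kernel C (e \<cdot> c') k" "k \<in> Hom C K T" using kernelE[OF ec'H] .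
  have ecok: "is_cokernel C k (e \<cdot> c')"
    using epic_short_exact[OF epic_Comp[OF ec' em(1) c'(2) em(2)] k(1)] by (simp add: short_exact_def)
  obtain I0 e0 m0 where m0: "epic C e0" "e0 \<in> Hom C X I0" "monic C m0" "m0 \<in> Hom C I0 T" "m0 \<cdot> e0 = f"
    using epic_monic_factorization[OF f] .
  have tm0: "t \<cdot> m0 \<in> Hom C I0 Y" using Comp_Hom[OF m0(4) t] .
  have "t \<cdot> f = t \<cdot> m0 \<cdot> e0" using Comp_assoc[OF m0(2,4) t] m0(5) by simp
  then have "is_cokernel C (t \<cdot> m0) c" using cokernel_epic_Comp[OF m0(1,2) tm0] c(1) by simp
  then have kc: "is_kernel C c (t \<cdot> m0)"
    using monic_short_exact[OF monic_Comp[OF m0(3) tm m0(4) t]] by (simp add: short_exact_def)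
  have "c \<cdot> (t \<cdot> k) = j \<cdot> c' \<cdot> k" using Comp_assoc[OF k(2) t c(2)] j(2) by simp
  also have "\<dots> = m \<cdot> (e \<cdot> c') \<cdot> k" using Comp_assoc[OF c'(2) em(2,4)] em(5) by simp
  also have "\<dots> = m \<cdot> (e \<cdot> c' \<cdot> k)" using Comp_assoc[OF k(2) ec'H em(4)] by simp
  also have "\<dots> = Zero C K E"
    using kernel_zero[OF k(1) ec'H k(2)] Comp_Zero[OF em(4)] HomD(4)[OF k(2)] by simp
  finally obtain v where v: "v \<in> Hom C K I0" "t \<cdot> m0 \<cdot> v = t \<cdot> k"
    using kernel_factor[OF kc c(2) tm0 Comp_Hom[OF k(2) t]] by metis
  have "t \<cdot> (m0 \<cdot> v) = t \<cdot> k" using Comp_assoc[OF v(1) m0(4) t] v(2) by simp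
  then have mv: "m0 \<cdot> v = k" using monic_cancel[OF tm t Comp_Hom[OF v(1) m0(4)] k(2)] by simp
  have "is_cokernel C m0 c'" using cokernel_epic_Comp[OF m0(1,2,4)] m0(5) c'(1) by simp
  then have "c' \<cdot> m0 = Zero C I0 D" using cokernel_zero m0(4) c'(2) by blast
  then have "c' \<cdot> k = Zero C K D"
    using Comp_assoc[OF v(1) m0(4) c'(2)] mv Zero_Comp[OF v(1)] HomD(5)[OF c'(2)] by simp
  then obtain w where w: "w \<in> Hom C I D" "w \<cdot> (e \<cdot> c') = c'"
    using cokernel_factor[OF ecok k(2) ec'H c'(2)] by metis
  have o: "D \<in> Obj C" using HomD(4)[OF j(1)] .
  have "w \<cdot> e \<cdot> c' = Ident C D \<cdot> c'"
    using Comp_assoc[OF c'(2) em(2) w(1)] w(2) Ident_Comp[OF c'(2)] by simp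
  then have "w \<cdot> e = Ident C D"
    using epic_cancel[OF ec' c'(2) Comp_Hom[OF em(2) w(1)] Ident_Hom[OF o]] by simp
  then have "monic C e" using monic_right_factor[OF _ em(2) w(1)] monic_Ident[OF o] by simp
  then have "monic C j" using monic_Comp[OF _ em(3,2,4)] em(5) by simp
  then have "short_exact C j p'" using monic_short_exact cok by blast
  then show thesis using that j p' by blast
qed

lemma biproductE:
  assumes "X \<in> Obj C" "Y \<in> Obj C"
  obtains B i j p q where "i \<in> Hom C X B" "j \<in> Hom C Y B" "p \<in> Hom C B X" "q \<in> Hom C B Y"
    "p \<cdot> i = Ident C X" "q \<cdot> j = Ident C Y" "p \<cdot> j = Zero C Y X" "q \<cdot> i = Zero C X Y"
    "(i \<cdot> p) \<boxplus> (j \<cdot> q) = Ident C B"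
proof -
  obtain B i j p q where B: "i \<in> Hom C X B" "j \<in> Hom C Y B" "p \<in> Hom C B X" "q \<in> Hom C B Y"
    "p \<cdot> i = Ident C X" "q \<cdot> j = Ident C Y" "(i \<cdot> p) \<boxplus> (j \<cdot> q) = Ident C B"
    using biproduct_ex[OF assms] by blast
  have o: "B \<in> Obj C" using HomD(5)[OF B(1)] .
  have ip: "i \<cdot> p \<in> Hom C B B" and jq: "j \<cdot> q \<in> Hom C B B"
    using Comp_Hom B(1-4) by blast+
  have pj: "p \<cdot> j \<in> Hom C Y X" and qi: "q \<cdot> i \<in> Hom C X Y" using Comp_Hom B(1-4) by blast+
  have ipj: "i \<cdot> p \<cdot> j \<in> Hom C Y B" and jqi: "j \<cdot> q \<cdot> i \<in> Hom C X B"
    using Comp_Hom ip jq B(1,2) by blast+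
  have "j = (i \<cdot> p \<boxplus> j \<cdot> q) \<cdot> j" using B(7) Ident_Comp[OF B(2)] by simp
  also have "\<dots> = (i \<cdot> p \<cdot> j) \<boxplus> (j \<cdot> q \<cdot> j)" using Comp_Add_left[OF B(2) ip jq] .
  also have "j \<cdot> q \<cdot> j = j" using Comp_assoc[OF B(2,4,2)] B(6) Comp_Ident[OF B(2)] by simp
  finally have "i \<cdot> p \<cdot> j = Zero C Y B" using Add_eq_self[OF B(2) ipj] by simp
  then have "p \<cdot> (i \<cdot> p \<cdot> j) = Zero C Y X" using Comp_Zero[OF B(3)] assms by simp
  moreover have "p \<cdot> (i \<cdot> p \<cdot> j) = p \<cdot> j"
    using Comp_assoc[OF B(2,3,1)] Comp_assoc[OF pj B(1,3)] B(5) Ident_Comp[OF pj] by simp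
  ultimately have pj0: "p \<cdot> j = Zero C Y X" by simp
  have "q = q \<cdot> (i \<cdot> p \<boxplus> j \<cdot> q)" using B(7) Comp_Ident[OF B(4)] by simp
  also have "\<dots> = (q \<cdot> (i \<cdot> p)) \<boxplus> (q \<cdot> (j \<cdot> q))" using Comp_Add_right[OF ip jq B(4)] .
  also have "q \<cdot> (j \<cdot> q) = q" using Comp_assoc[OF B(4,2,4)] B(6) Ident_Comp[OF B(4)] by simp
  finally have qip: "q \<cdot> (i \<cdot> p) = Zero C B Y"
    using Add_eq_self[OF B(4) Comp_Hom[OF ip B(4)]] by simp
  have "q \<cdot> i = q \<cdot> i \<cdot> (p \<cdot> i)" using B(5) Comp_Ident[OF qi] by simp
  also have "\<dots> = q \<cdot> i \<cdot> p \<cdot> i" using Comp_assoc[OF B(1,3) qi] by simp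
  also have "\<dots> = Zero C X Y"
    using Comp_assoc[OF B(3,1,4)] qip Zero_Comp[OF B(1)] assms by simp
  finally show thesis using that B pj0 by blast
qed

text \<open>Pushing out \<open>0 \<rightarrow> K \<rightarrow> X \<rightarrow> Z \<rightarrow> 0\<close> along \<open>\<phi>: K \<rightarrow> Y\<close>. The pushout \<open>P\<close> is the cokernel of
  \<open>(k, -\<phi>): K \<rightarrow> X \<oplus> Y\<close>. It is an extension of \<open>Z\<close> by \<open>Y\<close>, and \<open>X \<rightarrow> P\<close> has the same cokernel as
  \<open>\<phi>\<close>.\<close>

lemma pushout:
  assumes se: "short_exact C k e" and k: "k \<in> Hom C K X" and e: "e \<in> Hom C X Z"
    and phi: "\<phi> \<in> Hom C K Y" and d: "is_cokernel C \<phi> d" "d \<in> Hom C Y D"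
  obtains P a b x d' where "a \<in> Hom C Y P" "b \<in> Hom C P Z" "short_exact C a b"
    "x \<in> Hom C X P" "d' \<in> Hom C P D" "is_cokernel C x d'"
proof -
  have ke: "is_kernel C e k" "is_cokernel C k e" using se by (auto simp: short_exact_def)
  have o: "K \<in> Obj C" "X \<in> Obj C" "Y \<in> Obj C" "Z \<in> Obj C" "D \<in> Obj C"
    using HomD k e d(2) phi by blast+
  obtain B i j p q where i: "i \<in> Hom C X B" and j: "j \<in> Hom C Y B" and p: "p \<in> Hom C B X"
    and q: "q \<in> Hom C B Y" and pi: "p \<cdot> i = Ident C X" and qj: "q \<cdot> j = Ident C Y"
    and pj: "p \<cdot> j = Zero C Y X" and qi: "q \<cdot> i = Zero C X Y" and id: "(i \<cdot> p) \<boxplus> (j \<cdot> q) = Ident C B"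
    using biproductE[OF o(2,3)] .
  have ext: "u = v" if u: "u \<in> Hom C B W" and v: "v \<in> Hom C B W"
    and ui: "u \<cdot> i = v \<cdot> i" and uj: "u \<cdot> j = v \<cdot> j" for u v W
  proof -
    have *: "w = (w \<cdot> i \<cdot> p) \<boxplus> (w \<cdot> j \<cdot> q)" if w: "w \<in> Hom C B W" for w
      using Comp_Add_right[OF Comp_Hom[OF p i] Comp_Hom[OF q j] w] id Comp_Ident[OF w]
        Comp_assoc[OF p i w] Comp_assoc[OF q j w] by simp
    show ?thesis by (rule trans[OF *[OF u]]) (simp only: ui uj *[OF v, symmetric])
  qed
  obtain \<psi> where psi: "\<psi> \<in> Hom C K Y" "\<phi> \<boxplus> \<psi> = Zero C K Y" using negative_ex[OF phi] by blast
  \<comment> \<open>\<open>\<psi>\<close> is \<open>-\<phi>\<close>, so \<open>s\<close> is the map \<open>(k, -\<phi>)\<close> into the biproduct.\<close>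
  define s where "s = (i \<cdot> k) \<boxplus> (j \<cdot> \<psi>)"
  have ik: "i \<cdot> k \<in> Hom C K B" and jpsi: "j \<cdot> \<psi> \<in> Hom C K B" and jphi: "j \<cdot> \<phi> \<in> Hom C K B"
    using Comp_Hom i k j psi(1) phi by blast+
  have s: "s \<in> Hom C K B" unfolding s_def using Add_Hom[OF ik jpsi] .
  have ps: "p \<cdot> s = k"
  proof -
    have "p \<cdot> s = (p \<cdot> (i \<cdot> k)) \<boxplus> (p \<cdot> (j \<cdot> \<psi>))" unfolding s_def by (rule Comp_Add_right[OF ik jpsi p])
    also have "p \<cdot> (i \<cdot> k) = k" using Comp_assoc[OF k i p] pi Ident_Comp[OF k] by simp
    also have "p \<cdot> (j \<cdot> \<psi>) = Zero C K X"
      using Comp_assoc[OF psi(1) j p] pj Zero_Comp[OF psi(1) o(2)] by simp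
    finally show ?thesis using Add_Zero[OF k] by simp
  qed
  have qs: "q \<cdot> s = \<psi>"
  proof -
    have "q \<cdot> s = (q \<cdot> (i \<cdot> k)) \<boxplus> (q \<cdot> (j \<cdot> \<psi>))" unfolding s_def by (rule Comp_Add_right[OF ik jpsi q])
    also have "q \<cdot> (j \<cdot> \<psi>) = \<psi>" using Comp_assoc[OF psi(1) j q] qj Ident_Comp[OF psi(1)] by simp
    also have "q \<cdot> (i \<cdot> k) = Zero C K Y"
      using Comp_assoc[OF k i q] qi Zero_Comp[OF k o(3)] by simp
    finally show ?thesis using Zero_Add[OF psi(1)] by simp
  qed
  have "monic C s" using monic_right_factor[OF _ s p] ps kernel_monic[OF ke(1)] by simp
  obtain P \<pi> where pi_c: "is_cokernel C s \<pi>" and pi_H: "\<pi> \<in> Hom C B P" using cokernelE[OF s] .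
  have pi_k: "is_kernel C \<pi> s"
    using monic_short_exact[OF \<open>monic C s\<close> pi_c] by (simp add: short_exact_def)
  have pi_e: "epic C \<pi>" using cokernel_epic[OF pi_c] .
  have oP: "P \<in> Obj C" using HomD(5)[OF pi_H] .
  define a where "a = \<pi> \<cdot> j"
  define x where "x = \<pi> \<cdot> i"
  have a: "a \<in> Hom C Y P" and x: "x \<in> Hom C X P" unfolding a_def x_def using Comp_Hom i j pi_H by blast+
  have square: "x \<cdot> k = a \<cdot> \<phi>"
  proof -
    have xk: "x \<cdot> k \<in> Hom C K P" and ap: "a \<cdot> \<phi> \<in> Hom C K P" and aq: "a \<cdot> \<psi> \<in> Hom C K P"
      using Comp_Hom x k a phi psi(1) by blast+
    have "(x \<cdot> k) \<boxplus> (a \<cdot> \<psi>) = \<pi> \<cdot> s"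
      unfolding s_def x_def a_def
      using Comp_Add_right[OF ik jpsi pi_H] Comp_assoc[OF k i pi_H] Comp_assoc[OF psi(1) j pi_H] by simp
    also have "\<dots> = Zero C K P" using cokernel_zero[OF pi_c s pi_H] .
    also have "\<dots> = (a \<cdot> \<phi>) \<boxplus> (a \<cdot> \<psi>)"
      using Comp_Add_right[OF phi psi(1) a] psi(2) Comp_Zero[OF a o(1)] by simp
    finally show ?thesis using Add_right_cancel[OF xk ap aq] by simp
  qed
  \<comment> \<open>A morphism out of \<open>P\<close> is determined by its composites with \<open>x\<close> and \<open>a\<close>.\<close>
  have hom_P: "u = v" if u: "u \<in> Hom C P W" "v \<in> Hom C P W" and "u \<cdot> x = v \<cdot> x" "u \<cdot> a = v \<cdot> a" for u v W
  proof -
    have "u \<cdot> \<pi> = v \<cdot> \<pi>"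
      using that(3,4) Comp_assoc[OF i pi_H u(1)] Comp_assoc[OF i pi_H u(2)] Comp_assoc[OF j pi_H u(1)]
        Comp_assoc[OF j pi_H u(2)]
      by (intro ext[OF Comp_Hom[OF pi_H u(1)] Comp_Hom[OF pi_H u(2)]]) (simp_all add: x_def a_def)
    then show ?thesis using epic_cancel[OF pi_e pi_H u] by simp
  qed
  have epH: "e \<cdot> p \<in> Hom C B Z" using Comp_Hom[OF p e] .
  have "e \<cdot> p \<cdot> s = Zero C K Z" using Comp_assoc[OF s p e] ps kernel_zero[OF ke(1) e k] by simp
  then obtain b where b: "b \<in> Hom C P Z" "b \<cdot> \<pi> = e \<cdot> p"
    using cokernel_factor[OF pi_c s pi_H epH] by metis
  have bx: "b \<cdot> x = e"
    using Comp_assoc[OF i pi_H b(1)] b(2) Comp_assoc[OF i p e] pi Comp_Ident[OF e] by (simp add: x_def)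
  have ba: "b \<cdot> a = Zero C Y Z"
    using Comp_assoc[OF j pi_H b(1)] b(2) Comp_assoc[OF j p e] pj Comp_Zero[OF e o(3)] by (simp add: a_def)
  have be: "epic C b" using epic_left_factor[OF _ x b(1)] bx cokernel_epic[OF ke(2)] by simp
  have "is_cokernel C a b"
  proof (rule is_cokernelI[OF a b(1) ba be])
    fix W u assume u: "u \<in> Hom C P W" "u \<cdot> a = Zero C Y W"
    have oW: "W \<in> Obj C" using HomD(5)[OF u(1)] .
    have "u \<cdot> x \<cdot> k = u \<cdot> a \<cdot> \<phi>"
      using Comp_assoc[OF k x u(1)] Comp_assoc[OF phi a u(1)] square by simp
    also have "\<dots> = Zero C K W" using u(2) Zero_Comp[OF phi oW] by simp
    finally obtain v where v: "v \<in> Hom C Z W" "v \<cdot> e = u \<cdot> x"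
      using cokernel_factor[OF ke(2) k e Comp_Hom[OF x u(1)]] by metis
    have "v \<cdot> b = u"
    proof (rule hom_P[OF Comp_Hom[OF b(1) v(1)] u(1)])
      show "v \<cdot> b \<cdot> x = u \<cdot> x" using Comp_assoc[OF x b(1) v(1)] bx v(2) by simp
      show "v \<cdot> b \<cdot> a = u \<cdot> a"
        using Comp_assoc[OF a b(1) v(1)] ba Comp_Zero[OF v(1) o(3)] u(2) by simp
    qed
    then show "\<exists>v\<in>Hom C Z W. v \<cdot> b = u" using v(1) by blast
  qed
  moreover have "monic C a"
  proof (rule monicI[OF a])
    fix W g assume g: "g \<in> Hom C W Y" "a \<cdot> g = Zero C W P"
    have oW: "W \<in> Obj C" using HomD(4)[OF g(1)] .
    have jg: "j \<cdot> g \<in> Hom C W B" using Comp_Hom[OF g(1) j] .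
    have "\<pi> \<cdot> (j \<cdot> g) = Zero C W P" using Comp_assoc[OF g(1) j pi_H] g(2) by (simp add: a_def)
    then obtain h where h: "h \<in> Hom C W K" "s \<cdot> h = j \<cdot> g"
      using kernel_factor[OF pi_k pi_H s jg] by metis
    have "k \<cdot> h = p \<cdot> (s \<cdot> h)" using Comp_assoc[OF h(1) s p] ps by simp
    also have "\<dots> = Zero C W X"
      using h(2) Comp_assoc[OF g(1) j p] pj Zero_Comp[OF g(1) o(2)] by simp
    finally have "h = Zero C W K" using monic_zero[OF kernel_monic[OF ke(1)] k h(1)] by simp
    then have "j \<cdot> g = Zero C W B" using h(2) Comp_Zero[OF s oW] by simp
    then have "q \<cdot> (j \<cdot> g) = Zero C W Y" using Comp_Zero[OF q oW] by simp
    then show "g = Zero C W Y" using Comp_assoc[OF g(1) j q] qj Ident_Comp[OF g(1)] by simp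
  qed
  ultimately have "short_exact C a b" using monic_short_exact by blast
  have dq: "d \<cdot> q \<in> Hom C B D" using Comp_Hom[OF q d(2)] .
  have dpsi: "d \<cdot> \<psi> = Zero C K D"
  proof -
    have "(d \<cdot> \<psi>) = (d \<cdot> \<phi>) \<boxplus> (d \<cdot> \<psi>)"
      using cokernel_zero[OF d(1) phi d(2)] Zero_Add[OF Comp_Hom[OF psi(1) d(2)]] by simp
    also have "\<dots> = Zero C K D"
      using Comp_Add_right[OF phi psi(1) d(2)] psi(2) Comp_Zero[OF d(2) o(1)] by simp
    finally show ?thesis .
  qed
  have "d \<cdot> q \<cdot> s = Zero C K D" using Comp_assoc[OF s q d(2)] qs dpsi by simp
  then obtain d' where d': "d' \<in> Hom C P D" "d' \<cdot> \<pi> = d \<cdot> q"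
    using cokernel_factor[OF pi_c s pi_H dq] by metis
  have dx: "d' \<cdot> x = Zero C X D"
    using Comp_assoc[OF i pi_H d'(1)] d'(2) Comp_assoc[OF i q d(2)] qi Comp_Zero[OF d(2) o(2)]
    by (simp add: x_def)
  have da: "d' \<cdot> a = d"
    using Comp_assoc[OF j pi_H d'(1)] d'(2) Comp_assoc[OF j q d(2)] qj Comp_Ident[OF d(2)]
    by (simp add: a_def)
  have de: "epic C d'" using epic_left_factor[OF _ a d'(1)] da cokernel_epic[OF d(1)] by simp
  have "is_cokernel C x d'"
  proof (rule is_cokernelI[OF x d'(1) dx de])
    fix W u assume u: "u \<in> Hom C P W" "u \<cdot> x = Zero C X W"
    have oW: "W \<in> Obj C" using HomD(5)[OF u(1)] .
    have "u \<cdot> a \<cdot> \<phi> = u \<cdot> x \<cdot> k"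
      using Comp_assoc[OF k x u(1)] Comp_assoc[OF phi a u(1)] square by simp
    also have "\<dots> = Zero C K W" using u(2) Zero_Comp[OF k oW] by simp
    finally obtain v where v: "v \<in> Hom C D W" "v \<cdot> d = u \<cdot> a"
      using cokernel_factor[OF d(1) phi d(2) Comp_Hom[OF a u(1)]] by metis
    have "v \<cdot> d' = u"
    proof (rule hom_P[OF Comp_Hom[OF d'(1) v(1)] u(1)])
      show "v \<cdot> d' \<cdot> x = u \<cdot> x"
        using Comp_assoc[OF x d'(1) v(1)] dx Comp_Zero[OF v(1) o(2)] u(2) by simp
      show "v \<cdot> d' \<cdot> a = u \<cdot> a" using Comp_assoc[OF a d'(1) v(1)] da v(2) by simp
    qed
    then show "\<exists>v\<in>Hom C D W. v \<cdot> d' = u" using v(1) by blast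
  qed
  with \<open>short_exact C a b\<close> show thesis using that a b(1) x d'(1) by blast
qed

end

section \<open>Length\<close>

text \<open>Being built from \<open>n\<close> simple factors, with the composition series peeled off from the top so
  that induction on \<open>n\<close> is available.\<close>

primrec composition_length :: "('o, 'm) category \<Rightarrow> nat \<Rightarrow> 'o \<Rightarrow> bool" where
  "composition_length C 0 A \<longleftrightarrow> zero_object C A"
| "composition_length C (Suc n) A \<longleftrightarrow>
     (\<exists>A' f g S. f \<in> Hom C A' A \<and> g \<in> Hom C A S \<and> short_exact C f g \<and> simple_object C S \<and>
        composition_length C n A')"

definition min_length :: "('o, 'm) category \<Rightarrow> 'o \<Rightarrow> nat" where
  "min_length C A = (LEAST n. composition_length C n A)"

context abelian_category
begin

lemma short_exactD:
  assumes "short_exact C f g"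
  shows "is_kernel C g f" "is_cokernel C f g" "monic C f" "epic C g"
  using assms kernel_monic cokernel_epic unfolding short_exact_def by blast+

lemma short_exact_iso:
  assumes se: "short_exact C f g" and f: "f \<in> Hom C X Y" and g: "g \<in> Hom C Y Z"
    and u: "is_iso C u" "u \<in> Hom C Y' Y"
  obtains v where "v \<in> Hom C Y Y'" "short_exact C (v \<cdot> f) (g \<cdot> u)"
proof -
  obtain v where v: "v \<in> Hom C Y Y'" "v \<cdot> u = Ident C Y'" "u \<cdot> v = Ident C Y" "is_iso C v"
    using is_iso_inverse[OF u] .
  have vf: "v \<cdot> f \<in> Hom C X Y'" and gu: "g \<cdot> u \<in> Hom C Y' Z"
    using Comp_Hom[OF f v(1)] Comp_Hom[OF u(2) g] .
  have uvf: "u \<cdot> (v \<cdot> f) = f" using Comp_assoc[OF f v(1) u(2)] v(3) Ident_Comp[OF f] by simp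
  have "is_kernel C (g \<cdot> u) (v \<cdot> f)"
  proof (rule is_kernelI[OF gu vf])
    show "g \<cdot> u \<cdot> (v \<cdot> f) = Zero C X Z"
      using Comp_assoc[OF vf u(2) g] uvf kernel_zero[OF short_exactD(1)[OF se] g f] by simp
    show "monic C (v \<cdot> f)" using monic_Comp[OF short_exactD(3)[OF se] iso_monic[OF v(4,1)] f v(1)] .
    fix W h assume h: "h \<in> Hom C W Y'" "g \<cdot> u \<cdot> h = Zero C W Z"
    have "g \<cdot> (u \<cdot> h) = Zero C W Z" using Comp_assoc[OF h(1) u(2) g] h(2) by simp
    then obtain w where w: "w \<in> Hom C W X" "f \<cdot> w = u \<cdot> h"
      using kernel_factor[OF short_exactD(1)[OF se] g f Comp_Hom[OF h(1) u(2)]] by metis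
    have "v \<cdot> f \<cdot> w = h"
      using Comp_assoc[OF w(1) f v(1)] w(2) Comp_assoc[OF h(1) u(2) v(1)] v(2) Ident_Comp[OF h(1)] by simp
    then show "\<exists>w\<in>Hom C W X. v \<cdot> f \<cdot> w = h" using w(1) by blast
  qed
  moreover have "epic C (g \<cdot> u)" using epic_Comp[OF iso_epic[OF u] short_exactD(4)[OF se] u(2) g] .
  ultimately show thesis using that v(1) epic_short_exact by blast
qed

lemma zero_object_if_Ident_zero:
  assumes "X \<in> Obj C" "Ident C X = Zero C X X"
  shows "zero_object C X"
proof -
  have "f = Zero C Y X" if f: "f \<in> Hom C Y X" for f Y
    using Ident_Comp[OF f] assms(2) Zero_Comp[OF f assms(1)] by simp
  moreover have "f = Zero C X Y" if f: "f \<in> Hom C X Y" for f Y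
    using Comp_Ident[OF f] assms(2) Comp_Zero[OF f assms(1)] by simp
  ultimately show ?thesis
    unfolding zero_object_def using assms(1) Zero_Hom by (intro conjI ballI) blast+
qed

lemma zero_object_isomorphic:
  assumes "zero_object C X" "u \<in> Hom C Y X" "is_iso C u"
  shows "zero_object C Y"
proof -
  obtain v where v: "v \<in> Hom C X Y" "v \<cdot> u = Ident C Y" using is_iso_inverse[OF assms(3,2)] .
  have "v = Zero C X Y" using zero_object_Hom(2)[OF assms(1) v(1)] .
  then have "Ident C Y = Zero C Y Y" using v(2) Zero_Comp[OF assms(2)] HomD(4)[OF assms(2)] by simp
  then show ?thesis using zero_object_if_Ident_zero HomD(4)[OF assms(2)] by blast
qed

lemma composition_length_iso:
  assumes "composition_length C n X" "u \<in> Hom C Y X" "is_iso C u"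
  shows "composition_length C n Y"
proof (cases n)
  case 0
  then show ?thesis using assms zero_object_isomorphic by simp
next
  case (Suc n')
  then obtain A f g S where A: "f \<in> Hom C A X" "g \<in> Hom C X S" "short_exact C f g"
    "simple_object C S" "composition_length C n' A" using assms(1) by auto
  obtain v where "v \<in> Hom C X Y" "short_exact C (v \<cdot> f) (g \<cdot> u)"
    using short_exact_iso[OF A(3,1,2) assms(3,2)] .
  then show ?thesis
    using Suc A(4,5) Comp_Hom[OF A(1)] Comp_Hom[OF assms(2) A(2)] by auto
qed

text \<open>Intersect the composition series of \<open>A\<close> with the subobject \<open>B\<close>: each factor of the result is
  a factor of \<open>A\<close> or zero, and if no factor gets lost then \<open>B = A\<close>.\<close>

lemma proper_subobject_shorter:
  "composition_length C n A \<Longrightarrow> monic C b \<Longrightarrow> b \<in> Hom C B A \<Longrightarrow>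
     is_iso C b \<or> (\<exists>m<n. composition_length C m B)"
proof (induction n arbitrary: A b B)
  case 0
  have z: "zero_object C A" using 0(1) by simp
  have "epic C b"
    using zero_object_Hom(2)[OF z] by (intro epicI[OF 0(3)])
  then show ?case using monic_epic_iso[OF 0(2) _ 0(3)] by blast
next
  case (Suc n)
  note b = Suc.prems(2,3)
  obtain A' f g S where A: "f \<in> Hom C A' A" "g \<in> Hom C A S" "short_exact C f g"
    "simple_object C S" "composition_length C n A'" using Suc.prems(1) by auto
  note fg = short_exactD[OF A(3)]
  have gb: "g \<cdot> b \<in> Hom C B S" using Comp_Hom[OF b(2) A(2)] .
  show ?case
  proof (cases "g \<cdot> b = Zero C B S")
    case True
    \<comment> \<open>\<open>B\<close> lies in \<open>A'\<close>; even if it is all of \<open>A'\<close>, the factor \<open>S\<close> is lost.\<close>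
    obtain b' where b': "b' \<in> Hom C B A'" "f \<cdot> b' = b"
      using kernel_factor[OF fg(1) A(2,1) b(2) True] .
    have "monic C b'" using monic_right_factor[OF _ b'(1) A(1)] b'(2) b(1) by simp
    then have "is_iso C b' \<or> (\<exists>m<n. composition_length C m B)"
      using Suc.IH[OF A(5) _ b'(1)] by blast
    then have "\<exists>m\<le>n. composition_length C m B"
      using composition_length_iso[OF A(5) b'(1)] less_imp_le by blast
    then show ?thesis using less_Suc_eq_le by blast
  next
    case False
    \<comment> \<open>\<open>B \<rightarrow> S\<close> is epic because \<open>S\<close> is simple, and its kernel \<open>K\<close> is the intersection of \<open>B\<close> and \<open>A'\<close>.\<close>
    obtain I e m where em: "epic C e" "e \<in> Hom C B I" "monic C m" "m \<in> Hom C I S" "m \<cdot> e = g \<cdot> b"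
      using epic_monic_factorization[OF gb] .
    have "\<not> zero_object C I"
    proof
      assume "zero_object C I"
      then have "e = Zero C B I" using zero_object_Hom(1) em(2) by blast
      then show False
        using em(5) False Comp_Zero[OF em(4)] HomD(4)[OF em(2)] by simp
    qed
    then have "is_iso C m"
      using A(4) em(3) HomD(2,3)[OF em(4)] unfolding simple_object_def by blast
    then have gbe: "epic C (g \<cdot> b)" using epic_Comp[OF em(1) iso_epic em(2,4)] em(4,5) by metis
    obtain K k where k: "is_kernel C (g \<cdot> b) k" "k \<in> Hom C K B" using kernelE[OF gb] .
    have se: "short_exact C k (g \<cdot> b)" using epic_short_exact[OF gbe k(1)] .
    have km: "monic C k" using kernel_monic[OF k(1)] .
    have "g \<cdot> (b \<cdot> k) = Zero C K S" using Comp_assoc[OF k(2) b(2) A(2)] kernel_zero[OF k(1) gb k(2)] by simp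
    then obtain k' where k': "k' \<in> Hom C K A'" "f \<cdot> k' = b \<cdot> k"
      using kernel_factor[OF fg(1) A(2,1) Comp_Hom[OF k(2) b(2)]] by metis
    have "monic C k'" using monic_right_factor[OF _ k'(1) A(1)] k'(2) monic_Comp[OF km b(1) k(2) b(2)] by simp
    then consider "is_iso C k'" | m where "m < n" "composition_length C m K"
      using Suc.IH[OF A(5) _ k'(1)] by blast
    then show ?thesis
    proof cases
      case 1
      have "epic C b"
      proof (rule epicI[OF b(2)])
        fix W u assume u: "u \<in> Hom C A W" "u \<cdot> b = Zero C B W"
        have oW: "W \<in> Obj C" using HomD(5)[OF u(1)] .
        have "u \<cdot> f \<cdot> k' = u \<cdot> b \<cdot> k"
          using Comp_assoc[OF k'(1) A(1) u(1)] Comp_assoc[OF k(2) b(2) u(1)] k'(2) by simp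
        then have "u \<cdot> f \<cdot> k' = Zero C K W" using u(2) Zero_Comp[OF k(2) oW] by simp
        then have "u \<cdot> f = Zero C A' W"
          using epic_zero[OF iso_epic[OF 1 k'(1)] k'(1) Comp_Hom[OF A(1) u(1)]] by simp
        then obtain v where v: "v \<in> Hom C S W" "v \<cdot> g = u"
          using cokernel_factor[OF fg(2) A(1,2) u(1)] by metis
        have "v \<cdot> (g \<cdot> b) = Zero C B W" using Comp_assoc[OF b(2) A(2) v(1)] v(2) u(2) by simp
        then have "v = Zero C S W" using epic_zero[OF gbe gb v(1)] by simp
        then show "u = Zero C A W" using v(2) Zero_Comp[OF A(2) oW] by simp
      qed
      then show ?thesis using monic_epic_iso[OF b(1) _ b(2)] by blast
    next
      case 2
      have "composition_length C (Suc m) B"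
        using k(2) gb se A(4) 2(2) by auto
      then show ?thesis using 2(1) by (meson Suc_less_eq)
    qed
  qed
qed

end

context abelian_length_category
begin

lemma composition_length_ex:
  assumes "A \<in> Obj C"
  shows "\<exists>n. composition_length C n A"
proof -
  obtain n X f g where X: "zero_object C (X 0)" "X n = A"
    "\<forall>i<n. f i \<in> Hom C (X i) (X (Suc i)) \<and> short_exact C (f i) (g i) \<and> simple_object C (Cod C (g i))"
    using finite_length[OF assms] unfolding finite_length_def by blast
  have "i \<le> n \<Longrightarrow> composition_length C i (X i)" for i
  proof (induction i)
    case 0
    then show ?case using X(1) by simp
  next
    case (Suc i)
    then have i: "f i \<in> Hom C (X i) (X (Suc i))" "short_exact C (f i) (g i)"
      "simple_object C (Cod C (g i))" using X(3) by auto
    have "g i \<in> Hom C (X (Suc i)) (Cod C (g i))"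
      using cokernel_Hom[OF short_exactD(2)[OF i(2)] i(1)] .
    then show ?case using i Suc by auto
  qed
  then show ?thesis using X(2) by blast
qed

lemma min_length_less:
  assumes "monic C b" "b \<in> Hom C B A" "\<not> is_iso C b"
  shows "min_length C B < min_length C A"
proof -
  have "composition_length C (min_length C A) A"
    unfolding min_length_def using composition_length_ex[OF HomD(5)[OF assms(2)]] by (rule LeastI_ex)
  then obtain m where m: "m < min_length C A" "composition_length C m B"
    using proper_subobject_shorter assms by blast
  have "min_length C B \<le> m" unfolding min_length_def using m(2) by (rule Least_le)
  then show ?thesis using m(1) by simp
qed

lemma min_length_le:
  assumes "monic C b" "b \<in> Hom C B A"
  shows "min_length C B \<le> min_length C A"
proof (cases "is_iso C b")
  case True
  have "composition_length C (min_length C A) A"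
    unfolding min_length_def using composition_length_ex[OF HomD(5)[OF assms(2)]] by (rule LeastI_ex)
  then have "composition_length C (min_length C A) B" using composition_length_iso assms(2) True by blast
  then show ?thesis unfolding min_length_def[of C B] by (rule Least_le)
next
  case False
  then show ?thesis using min_length_less assms less_imp_le by blast
qed

end

section \<open>Subcategories\<close>

context abelian_category
begin

lemma subcategory_iso:
  assumes "subcategory C S" "isomorphic C X Y" "X \<in> S"
  shows "Y \<in> S"
proof -
  obtain f where "f \<in> Hom C X Y" using assms(2) unfolding isomorphic_def by blast
  then show ?thesis using assms HomD(5) unfolding subcategory_def by blast
qed

lemma subcategory_Obj: "subcategory C S \<Longrightarrow> X \<in> S \<Longrightarrow> X \<in> Obj C"
  unfolding subcategory_def by blast

lemma subcategory_zero_object: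
  assumes "subcategory C S" "zero_object C Z"
  shows "Z \<in> S"
  using assms isomorphic_zero_objects subcategory_iso unfolding subcategory_def by blast

lemma torsion_free_classD:
  assumes "torsion_free_class C F"
  shows "subcategory C F" "extension_closed C F" "subobject_closed C F"
  using assms unfolding torsion_free_class_def by blast+

lemma subobject_closedD:
  "subobject_closed C S \<Longrightarrow> monic C m \<Longrightarrow> m \<in> Hom C X Y \<Longrightarrow> Y \<in> S \<Longrightarrow> X \<in> S"
  unfolding subobject_closed_def Hom_iff by blast

lemma extension_closedD:
  "extension_closed C S \<Longrightarrow> short_exact C f g \<Longrightarrow> f \<in> Hom C X Y \<Longrightarrow> g \<in> Hom C Y Z \<Longrightarrow>
     X \<in> S \<Longrightarrow> Z \<in> S \<Longrightarrow> Y \<in> S"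
  unfolding extension_closed_def Hom_iff by blast

lemma extension_closedI:
  assumes "\<And>f g X Y Z. short_exact C f g \<Longrightarrow> f \<in> Hom C X Y \<Longrightarrow> g \<in> Hom C Y Z \<Longrightarrow>
     X \<in> S \<Longrightarrow> Z \<in> S \<Longrightarrow> Y \<in> S"
  shows "extension_closed C S"
  unfolding extension_closed_def
proof (intro allI impI)
  fix f g assume fg: "short_exact C f g \<and> Dom C f \<in> S \<and> Cod C g \<in> S"
  then have "is_kernel C g f" unfolding short_exact_def by blast
  note k = is_kernelD[OF this]
  have "f \<in> Hom C (Dom C f) (Cod C f)" "g \<in> Hom C (Cod C f) (Cod C g)"
    using k by (simp_all add: Hom_iff)
  then show "Cod C f \<in> S" using assms fg by blast
qed

lemma left_perp_iff:
  "M \<in> left_perp C G \<longleftrightarrow> M \<in> Obj C \<and> (\<forall>Y f. Y \<in> G \<longrightarrow> f \<in> Hom C M Y \<longrightarrow> f = Zero C M Y)"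
  if "G \<subseteq> Obj C"
proof -
  have "Hom C M Y = {Zero C M Y} \<longleftrightarrow> (\<forall>f. f \<in> Hom C M Y \<longrightarrow> f = Zero C M Y)"
    if "M \<in> Obj C" "Y \<in> Obj C" for Y
    using Zero_Hom[OF that] by blast
  then show ?thesis unfolding left_perp_def using that by blast
qed

lemma right_perp_iff:
  "M \<in> right_perp C S \<longleftrightarrow> M \<in> Obj C \<and> (\<forall>X f. X \<in> S \<longrightarrow> f \<in> Hom C X M \<longrightarrow> f = Zero C X M)"
  if "S \<subseteq> Obj C"
proof -
  have "Hom C X M = {Zero C X M} \<longleftrightarrow> (\<forall>f. f \<in> Hom C X M \<longrightarrow> f = Zero C X M)"
    if "X \<in> Obj C" "M \<in> Obj C" for X
    using Zero_Hom[OF that] by blast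
  then show ?thesis unfolding right_perp_def using that by blast
qed

lemma left_perp_antimono: "G' \<subseteq> G \<Longrightarrow> left_perp C G \<subseteq> left_perp C G'"
  unfolding left_perp_def by blast

lemma left_perp_quotient:
  assumes "G \<subseteq> Obj C" "X \<in> left_perp C G" "epic C e" "e \<in> Hom C X Y"
  shows "Y \<in> left_perp C G"
  unfolding left_perp_iff[OF assms(1)]
proof (intro conjI allI impI)
  show "Y \<in> Obj C" using HomD(5)[OF assms(4)] .
  fix Z f assume Z: "Z \<in> G" and f: "f \<in> Hom C Y Z"
  have "f \<cdot> e = Zero C X Z"
    using assms(2) Z Comp_Hom[OF assms(4) f] unfolding left_perp_iff[OF assms(1)] by blast
  then show "f = Zero C Y Z" using epic_zero[OF assms(3,4) f] by simp
qed

lemma left_perp_extension: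
  assumes "G \<subseteq> Obj C" "short_exact C f g" "f \<in> Hom C X Y" "g \<in> Hom C Y Z"
    "X \<in> left_perp C G" "Z \<in> left_perp C G"
  shows "Y \<in> left_perp C G"
  unfolding left_perp_iff[OF assms(1)]
proof (intro conjI allI impI)
  show "Y \<in> Obj C" using HomD(5)[OF assms(3)] .
  fix W h assume W: "W \<in> G" and h: "h \<in> Hom C Y W"
  have "h \<cdot> f = Zero C X W"
    using assms(5) W Comp_Hom[OF assms(3) h] unfolding left_perp_iff[OF assms(1)] by blast
  then obtain u where u: "u \<in> Hom C Z W" "u \<cdot> g = h"
    using cokernel_factor[OF short_exactD(2)[OF assms(2)] assms(3,4) h] by metis
  then have "u = Zero C Z W" using assms(6) W unfolding left_perp_iff[OF assms(1)] by blast
  then show "h = Zero C Y W" using u(2) Zero_Comp[OF assms(4) HomD(5)[OF h]] by simp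
qed

lemma right_perp_subobject:
  assumes "S \<subseteq> Obj C" "Y \<in> right_perp C S" "monic C m" "m \<in> Hom C X Y"
  shows "X \<in> right_perp C S"
  unfolding right_perp_iff[OF assms(1)]
proof (intro conjI allI impI)
  show "X \<in> Obj C" using HomD(4)[OF assms(4)] .
  fix Z f assume Z: "Z \<in> S" and f: "f \<in> Hom C Z X"
  have "m \<cdot> f = Zero C Z Y"
    using assms(2) Z Comp_Hom[OF f assms(4)] unfolding right_perp_iff[OF assms(1)] by blast
  then show "f = Zero C Z X" using monic_zero[OF assms(3,4) f] by simp
qed

lemma right_perp_extension:
  assumes "S \<subseteq> Obj C" "short_exact C f g" "f \<in> Hom C X Y" "g \<in> Hom C Y Z"
    "X \<in> right_perp C S" "Z \<in> right_perp C S"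
  shows "Y \<in> right_perp C S"
  unfolding right_perp_iff[OF assms(1)]
proof (intro conjI allI impI)
  show "Y \<in> Obj C" using HomD(5)[OF assms(3)] .
  fix W h assume W: "W \<in> S" and h: "h \<in> Hom C W Y"
  have "g \<cdot> h = Zero C W Z"
    using assms(6) W Comp_Hom[OF h assms(4)] unfolding right_perp_iff[OF assms(1)] by blast
  then obtain u where u: "u \<in> Hom C W X" "f \<cdot> u = h"
    using kernel_factor[OF short_exactD(1)[OF assms(2)] assms(4,3) h] by metis
  then have "u = Zero C W X" using assms(5) W unfolding right_perp_iff[OF assms(1)] by blast
  then show "h = Zero C W Y" using u(2) Comp_Zero[OF assms(3) HomD(4)[OF h]] by simp
qed

lemma heart_subcategory:
  assumes "torsion_free_class C F" "G \<subseteq> Obj C"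
  shows "subcategory C (heart C G F)"
  unfolding subcategory_def
proof (intro conjI ballI impI)
  note F = torsion_free_classD[OF assms(1)]
  show "heart C G F \<subseteq> Obj C" using F(1) unfolding heart_def subcategory_def by blast
  fix X Y assume X: "X \<in> heart C G F" and iso: "isomorphic C X Y"
  obtain f where f: "f \<in> Hom C X Y" "is_iso C f" using iso unfolding isomorphic_def by blast
  have "Y \<in> F" using subcategory_iso[OF F(1) iso] X unfolding heart_def by blast
  moreover have "Y \<in> left_perp C G"
    using left_perp_quotient[OF assms(2) _ iso_epic[OF f(2,1)] f(1)] X unfolding heart_def by blast
  ultimately show "Y \<in> heart C G F" unfolding heart_def by blast
next
  obtain Z where Z: "zero_object C Z" using zero_object_ex by blast
  then have "Z \<in> left_perp C G"
    unfolding left_perp_iff[OF assms(2)]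
  proof (intro conjI allI impI)
    show "Z \<in> Obj C" using Z unfolding zero_object_def by blast
    fix Y f assume "f \<in> Hom C Z Y"
    then show "f = Zero C Z Y" using zero_object_Hom(2)[OF Z] by blast
  qed
  then have "Z \<in> heart C G F"
    using subcategory_zero_object[OF torsion_free_classD(1)[OF assms(1)] Z] unfolding heart_def by blast
  then show "\<exists>Z\<in>heart C G F. zero_object C Z" using Z by blast
qed

lemma heart_extension_closed:
  assumes "torsion_free_class C F" "G \<subseteq> Obj C"
  shows "extension_closed C (heart C G F)"
proof (rule extension_closedI)
  fix f g X Y Z
  assume "short_exact C f g" "f \<in> Hom C X Y" "g \<in> Hom C Y Z" "X \<in> heart C G F" "Z \<in> heart C G F"
  then show "Y \<in> heart C G F"
    using left_perp_extension[OF assms(2)] extension_closedD[OF torsion_free_classD(2)[OF assms(1)]]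
    unfolding heart_def by blast
qed

section \<open>Short exact sequences inside a wide subcategory\<close>

lemma full_subcategory_simps [simp]:
  "Obj (full_subcategory C S) = S"
  "Arr (full_subcategory C S) = {f \<in> Arr C. Dom C f \<in> S \<and> Cod C f \<in> S}"
  "Dom (full_subcategory C S) = Dom C" "Cod (full_subcategory C S) = Cod C"
  "Ident (full_subcategory C S) = Ident C" "Comp (full_subcategory C S) = Comp C"
  "Zero (full_subcategory C S) = Zero C"
  by (simp_all add: full_subcategory_def)

lemma full_subcategory_Hom:
  "X \<in> S \<Longrightarrow> Y \<in> S \<Longrightarrow> Hom (full_subcategory C S) X Y = Hom C X Y"
  by (auto simp: Hom_def)

lemma full_subcategory_isomorphic:
  assumes "isomorphic (full_subcategory C S) X Y"
  shows "isomorphic C X Y"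
proof -
  obtain f where f: "f \<in> Hom (full_subcategory C S) X Y" "is_iso (full_subcategory C S) f"
    using assms unfolding isomorphic_def by blast
  have fH: "f \<in> Hom C X Y" and XY: "X \<in> S" "Y \<in> S" using f(1) by (auto simp: Hom_def)
  have "is_iso C f"
    using f(2) XY HomD(1-3)[OF fH] unfolding is_iso_def
    by (simp add: full_subcategory_Hom)
  then show ?thesis using fH unfolding isomorphic_def by blast
qed

lemma full_subcategory_zero_object:
  assumes "S \<subseteq> Obj C" "zero_object C Z" "Z \<in> S"
  shows "zero_object (full_subcategory C S) Z"
  using assms unfolding zero_object_def by (simp add: full_subcategory_Hom subset_iff)

text \<open>An epimorphism of \<open>W\<close> has a cokernel in \<open>C\<close> whose target lies in \<open>W\<close>; that cokernel must be
  zero.\<close>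

lemma full_subcategory_epic:
  assumes W: "wide C W" and f: "epic (full_subcategory C W) f"
  shows "epic C f"
proof -
  define X Y where "X = Dom C f" "Y = Cod C f"
  have XY: "X \<in> W" "Y \<in> W" and fH: "f \<in> Hom C X Y"
    using f unfolding epic_def by (auto simp: X_Y_def Hom_iff)
  obtain Q c where c: "is_cokernel C f c" "c \<in> Hom C Y Q" using cokernelE[OF fH] .
  have Q: "Q \<in> W"
    using W XY fH c HomD(3)[OF c(2)] unfolding wide_def cokernel_closed_def by blast
  have o: "X \<in> Obj C" "Y \<in> Obj C" "Q \<in> Obj C" using HomD(4,5)[OF fH] HomD(5)[OF c(2)] by auto
  have z: "Zero C Y Q \<in> Hom C Y Q" using Zero_Hom o by blast
  have "c \<cdot> f = Zero C Y Q \<cdot> f" using cokernel_zero[OF c(1) fH c(2)] Zero_Comp[OF fH o(3)] by simp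
  then have c0: "c = Zero C Y Q"
    using f XY Q c(2) z full_subcategory_Hom[OF XY(2) Q] unfolding epic_def
    by (simp add: X_Y_def)
  show ?thesis
  proof (rule epicI[OF fH])
    fix V g assume g: "g \<in> Hom C Y V" "g \<cdot> f = Zero C X V"
    then obtain u where u: "u \<in> Hom C Q V" "u \<cdot> c = g" using cokernel_factor[OF c(1) fH c(2)] by metis
    then show "g = Zero C Y V" using c0 Comp_Zero[OF u(1) o(2)] by simp
  qed
qed

text \<open>Kernels and cokernels in \<open>C\<close> of morphisms of \<open>W\<close> lie in \<open>W\<close> and hence are also kernels and
  cokernels in \<open>W\<close>. By uniqueness those of \<open>W\<close> agree with those of \<open>C\<close>.\<close>

lemma full_subcategory_kernel:
  assumes W: "wide C W" and k: "is_kernel (full_subcategory C W) f k"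
  shows "is_kernel C f k"
proof -
  define X Y K where "X = Dom C f" "Y = Cod C f" "K = Dom C k"
  have in_W: "X \<in> W" "Y \<in> W" "K \<in> W" and f: "f \<in> Hom C X Y" and kH: "k \<in> Hom C K X"
    and fk: "f \<cdot> k = Zero C K Y"
    and un: "\<forall>h\<in>Arr (full_subcategory C W). Cod C h = X \<and> f \<cdot> h = Zero C (Dom C h) Y \<longrightarrow>
        (\<exists>!u. u \<in> Hom (full_subcategory C W) (Dom C h) K \<and> k \<cdot> u = h)"
    using k unfolding is_kernel_def by (simp_all add: X_Y_K_def Hom_iff)
  obtain L l where l: "is_kernel C f l" "l \<in> Hom C L X" using kernelE[OF f] .
  have L: "L \<in> W"
    using W in_W f l HomD(2)[OF l(2)] unfolding wide_def kernel_closed_def by blast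
  have univ: "\<exists>!u. u \<in> Hom C V K \<and> k \<cdot> u = h"
    if h: "h \<in> Hom C V X" "f \<cdot> h = Zero C V Y" and V: "V \<in> W" for V h
    using un[rule_format, of h] h V in_W HomD[OF h(1)] full_subcategory_Hom[OF V in_W(3)] by simp
  obtain v where v: "v \<in> Hom C K L" "l \<cdot> v = k" using kernel_factor[OF l(1) f l(2) kH fk] .
  obtain u where u: "u \<in> Hom C L K" "k \<cdot> u = l"
    using univ[OF l(2) kernel_zero[OF l(1) f l(2)] L] by blast
  have idK: "Ident C K \<in> Hom C K K" using Ident_Hom[OF HomD(4)[OF kH]] .
  have kuv: "k \<cdot> (u \<cdot> v) = k" using Comp_assoc[OF v(1) u(1) kH] u(2) v(2) by simp
  have "u \<cdot> v = Ident C K"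
    using univ[OF kH fk in_W(3)] Comp_Hom[OF v(1) u(1)] idK kuv Comp_Ident[OF kH] by blast
  then have "monic C v" using monic_right_factor[OF _ v(1) u(1)] monic_Ident[OF HomD(4)[OF kH]] by simp
  then have km: "monic C k" using monic_Comp[OF _ kernel_monic[OF l(1)] v(1) l(2)] v(2) by simp
  show ?thesis
  proof (rule is_kernelI[OF f kH fk km])
    fix V h assume h: "h \<in> Hom C V X" "f \<cdot> h = Zero C V Y"
    obtain w where w: "w \<in> Hom C V L" "l \<cdot> w = h" using kernel_factor[OF l(1) f l(2) h] .
    have "k \<cdot> (u \<cdot> w) = h" using Comp_assoc[OF w(1) u(1) kH] u(2) w(2) by simp
    then show "\<exists>w\<in>Hom C V K. k \<cdot> w = h" using Comp_Hom[OF w(1) u(1)] by blast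
  qed
qed

lemma full_subcategory_cokernel:
  assumes W: "wide C W" and c: "is_cokernel (full_subcategory C W) f c"
  shows "is_cokernel C f c"
proof -
  define X Y Q where "X = Dom C f" "Y = Cod C f" "Q = Cod C c"
  have in_W: "X \<in> W" "Y \<in> W" "Q \<in> W" and f: "f \<in> Hom C X Y" and cH: "c \<in> Hom C Y Q"
    and cf: "c \<cdot> f = Zero C X Q"
    and un: "\<forall>h\<in>Arr (full_subcategory C W). Dom C h = Y \<and> h \<cdot> f = Zero C X (Cod C h) \<longrightarrow>
        (\<exists>!u. u \<in> Hom (full_subcategory C W) Q (Cod C h) \<and> u \<cdot> c = h)"
    using c unfolding is_cokernel_def by (simp_all add: X_Y_Q_def Hom_iff)
  obtain L l where l: "is_cokernel C f l" "l \<in> Hom C Y L" using cokernelE[OF f] .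
  have L: "L \<in> W"
    using W in_W f l HomD(3)[OF l(2)] unfolding wide_def cokernel_closed_def by blast
  have univ: "\<exists>!u. u \<in> Hom C Q V \<and> u \<cdot> c = h"
    if h: "h \<in> Hom C Y V" "h \<cdot> f = Zero C X V" and V: "V \<in> W" for V h
    using un[rule_format, of h] h V in_W HomD[OF h(1)] full_subcategory_Hom[OF in_W(3) V] by simp
  obtain v where v: "v \<in> Hom C L Q" "v \<cdot> l = c" using cokernel_factor[OF l(1) f l(2) cH cf] .
  obtain u where u: "u \<in> Hom C Q L" "u \<cdot> c = l"
    using univ[OF l(2) cokernel_zero[OF l(1) f l(2)] L] by blast
  have idQ: "Ident C Q \<in> Hom C Q Q" using Ident_Hom[OF HomD(5)[OF cH]] .
  have vuc: "v \<cdot> u \<cdot> c = c" using Comp_assoc[OF cH u(1) v(1)] u(2) v(2) by simp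
  have "v \<cdot> u = Ident C Q"
    using univ[OF cH cf in_W(3)] Comp_Hom[OF u(1) v(1)] idQ vuc Ident_Comp[OF cH] by blast
  then have "epic C v" using epic_left_factor[OF _ u(1) v(1)] epic_Ident[OF HomD(5)[OF cH]] by simp
  then have ce: "epic C c" using epic_Comp[OF cokernel_epic[OF l(1)] _ l(2) v(1)] v(2) by simp
  show ?thesis
  proof (rule is_cokernelI[OF f cH cf ce])
    fix V h assume h: "h \<in> Hom C Y V" "h \<cdot> f = Zero C X V"
    obtain w where w: "w \<in> Hom C L V" "w \<cdot> l = h" using cokernel_factor[OF l(1) f l(2) h] .
    have "w \<cdot> u \<cdot> c = h" using Comp_assoc[OF cH u(1) w(1)] u(2) w(2) by simp
    then show "\<exists>w\<in>Hom C Q V. w \<cdot> c = h" using Comp_Hom[OF u(1) w(1)] by blast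
  qed
qed

end

section \<open>Torsion sequences\<close>

context abelian_length_category
begin

text \<open>The decomposition of \<open>M\<close> with respect to the torsion pair \<open>(\<^sup>\<bottom>G, G)\<close>. Among the kernels of
  epimorphisms from \<open>M\<close> onto objects of \<open>G\<close> take a shortest one, \<open>K\<close>. A nonzero morphism from \<open>K\<close>
  to an object of \<open>G\<close> would have a kernel \<open>L\<close> smaller than \<open>K\<close>, and \<open>M/L\<close>, an extension of \<open>M/K\<close> by
  \<open>K/L\<close>, would again be in \<open>G\<close>.\<close>

lemma torsion_sequence:
  assumes G: "torsion_free_class C G" and M: "M \<in> Obj C"
  obtains K N k p where "k \<in> Hom C K M" "p \<in> Hom C M N" "short_exact C k p" "K \<in> left_perp C G" "N \<in> G"
proof -
  note Gs = torsion_free_classD[OF G]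
  have GO: "G \<subseteq> Obj C" using Gs(1) unfolding subcategory_def by blast
  define P where "P K \<longleftrightarrow> (\<exists>k N p. k \<in> Hom C K M \<and> p \<in> Hom C M N \<and> short_exact C k p \<and> N \<in> G)" for K
  \<comment> \<open>The zero quotient of \<open>M\<close> is in \<open>G\<close>.\<close>
  have "P M"
  proof -
    obtain Z where Z: "zero_object C Z" using zero_object_ex by blast
    have p: "Zero C M Z \<in> Hom C M Z" using Zero_Hom M Z unfolding zero_object_def by blast
    have "epic C (Zero C M Z)" using zero_object_Hom(2)[OF Z] by (intro epicI[OF p])
    moreover have "is_kernel C (Zero C M Z) (Ident C M)"
    proof (rule is_kernelI[OF p Ident_Hom[OF M] Comp_Ident[OF p] monic_Ident[OF M]])
      fix W h assume "h \<in> Hom C W M"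
      then show "\<exists>u\<in>Hom C W M. Ident C M \<cdot> u = h" using Ident_Comp by blast
    qed
    ultimately have "short_exact C (Ident C M) (Zero C M Z)" using epic_short_exact by blast
    then show ?thesis
      unfolding P_def using p Ident_Hom[OF M] subcategory_zero_object[OF Gs(1) Z] by blast
  qed
  then obtain K where K: "P K" and min: "\<And>L. P L \<Longrightarrow> min_length C K \<le> min_length C L"
    using ex_has_least_nat[of P M "min_length C"] by blast
  then obtain k N p where k: "k \<in> Hom C K M" and p: "p \<in> Hom C M N" and se: "short_exact C k p"
    and N: "N \<in> G" unfolding P_def by blast
  note kp = short_exactD[OF se]
  have "K \<in> left_perp C G"
    unfolding left_perp_iff[OF GO]
  proof (intro conjI allI impI)
    show "K \<in> Obj C" using HomD(4)[OF k] .
    fix Y \<phi> assume Y: "Y \<in> G" and phi: "\<phi> \<in> Hom C K Y"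
    obtain I e m where em: "epic C e" "e \<in> Hom C K I" "monic C m" "m \<in> Hom C I Y" "m \<cdot> e = \<phi>"
      using epic_monic_factorization[OF phi] .
    have I: "I \<in> G" using subobject_closedD[OF Gs(3) em(3,4) Y] .
    obtain L l where l: "is_kernel C e l" "l \<in> Hom C L K" using kernelE[OF em(2)] .
    have le: "is_cokernel C l e" and lm: "monic C l" using short_exactD[OF epic_short_exact[OF em(1) l(1)]] by blast+
    have kl: "k \<cdot> l \<in> Hom C L M" using Comp_Hom[OF l(2) k] .
    obtain Q c where c: "is_cokernel C (k \<cdot> l) c" "c \<in> Hom C M Q" using cokernelE[OF kl] .
    obtain j p' where "j \<in> Hom C I Q" "p' \<in> Hom C Q N" "short_exact C j p'"
      using third_isomorphism[OF l(2) k se p le em(2) c] by metis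
    then have "Q \<in> G" using extension_closedD[OF Gs(2)] I N by blast
    moreover have "short_exact C (k \<cdot> l) c"
      using monic_short_exact[OF monic_Comp[OF lm kp(3) l(2) k] c(1)] .
    ultimately have "P L" unfolding P_def using kl c(2) by blast
    then have "is_iso C l" using min min_length_less[OF lm l(2)] by (meson not_less)
    then have "e = Zero C K I"
      using epic_zero[OF iso_epic l(2) em(2)] l(2) kernel_zero[OF l(1) em(2) l(2)] by blast
    then show "\<phi> = Zero C K Y" using em(5) Comp_Zero[OF em(4) HomD(4)[OF k]] by simp
  qed
  then show thesis using that k p se N by blast
qed

section \<open>The wide subcategory of a torsion-free class\<close>

lemma W_RI:
  assumes F: "torsion_free_class C F" and X: "X \<in> F"
    and cok: "\<And>Y f. Y \<in> F \<Longrightarrow> f \<in> Hom C X Y \<Longrightarrow> \<exists>c Q. is_cokernel C f c \<and> c \<in> Hom C Y Q \<and> Q \<in> F"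
  shows "X \<in> W_R C F"
proof -
  have "Cod C c \<in> F" if Y: "Y \<in> F" and f: "f \<in> Hom C X Y" and c: "is_cokernel C f c" for Y f c
  proof -
    obtain c' Q where c': "is_cokernel C f c'" "c' \<in> Hom C Y Q" "Q \<in> F" using cok[OF Y f] by blast
    have "isomorphic C Q (Cod C c)" using cokernel_isomorphic[OF c'(1,2) c cokernel_Hom[OF c f]] .
    then show ?thesis using subcategory_iso[OF torsion_free_classD(1)[OF F]] c'(3) by blast
  qed
  then show ?thesis unfolding W_R_def using X by blast
qed

lemma W_RD: "X \<in> W_R C F \<Longrightarrow> Y \<in> F \<Longrightarrow> f \<in> Hom C X Y \<Longrightarrow> is_cokernel C f c \<Longrightarrow> c \<in> Hom C Y Q \<Longrightarrow> Q \<in> F"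
  unfolding W_R_def Hom_iff[of c] by blast

lemma W_R_subset: "W_R C F \<subseteq> F"
  unfolding W_R_def by blast

text \<open>A morphism out of the quotient \<open>I\<close> of \<open>X\<close> has the same cokernel as its composite with
  \<open>X \<rightarrow> I\<close>.\<close>

lemma W_R_quotient:
  assumes F: "torsion_free_class C F" and X: "X \<in> W_R C F" and e: "epic C e" "e \<in> Hom C X I" and I: "I \<in> F"
  shows "I \<in> W_R C F"
proof (rule W_RI[OF F I])
  fix Y f assume Y: "Y \<in> F" and f: "f \<in> Hom C I Y"
  obtain Q c where c: "is_cokernel C f c" "c \<in> Hom C Y Q" using cokernelE[OF f] .
  have "is_cokernel C (f \<cdot> e) c" using cokernel_epic_Comp[OF e f] c(1) by simp
  then have "Q \<in> F" using W_RD[OF X Y Comp_Hom[OF e(2) f]] c(2) by blast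
  then show "\<exists>c Q. is_cokernel C f c \<and> c \<in> Hom C Y Q \<and> Q \<in> F" using c by blast
qed

text \<open>For \<open>0 \<rightarrow> X \<rightarrow> Y \<rightarrow> Z \<rightarrow> 0\<close> and \<open>\<phi>: Y \<rightarrow> T\<close> divide \<open>T\<close> first by the image of \<open>X\<close> and then by that
  of \<open>Z\<close>; the result is the cokernel of \<open>\<phi>\<close>.\<close>

lemma W_R_extension_closed:
  assumes F: "torsion_free_class C F"
  shows "extension_closed C (W_R C F)"
proof (rule extension_closedI)
  fix f g X Y Z
  assume se: "short_exact C f g" and f: "f \<in> Hom C X Y" and g: "g \<in> Hom C Y Z"
    and X: "X \<in> W_R C F" and Z: "Z \<in> W_R C F"
  note fg = short_exactD[OF se]
  have "Y \<in> F" using extension_closedD[OF torsion_free_classD(2)[OF F] se f g] X Z W_R_subset by blast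
  then show "Y \<in> W_R C F"
  proof (rule W_RI[OF F])
    fix T \<phi> assume T: "T \<in> F" and phi: "\<phi> \<in> Hom C Y T"
    have pf: "\<phi> \<cdot> f \<in> Hom C X T" using Comp_Hom[OF f phi] .
    obtain D c where c: "is_cokernel C (\<phi> \<cdot> f) c" "c \<in> Hom C T D" using cokernelE[OF pf] .
    have D: "D \<in> F" using W_RD[OF X T pf c] .
    have cphi: "c \<cdot> \<phi> \<in> Hom C Y D" using Comp_Hom[OF phi c(2)] .
    have "c \<cdot> \<phi> \<cdot> f = Zero C X D" using Comp_assoc[OF f phi c(2)] cokernel_zero[OF c(1) pf c(2)] by simp
    then obtain h where h: "h \<in> Hom C Z D" "h \<cdot> g = c \<cdot> \<phi>"
      using cokernel_factor[OF fg(2) f g cphi] by metis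
    obtain Q d where d: "is_cokernel C h d" "d \<in> Hom C D Q" using cokernelE[OF h(1)] .
    have Q: "Q \<in> F" using W_RD[OF Z D h(1) d] .
    have dc: "d \<cdot> c \<in> Hom C T Q" using Comp_Hom[OF c(2) d(2)] .
    have "is_cokernel C \<phi> (d \<cdot> c)"
    proof (rule is_cokernelI[OF phi dc _ epic_Comp[OF cokernel_epic[OF c(1)] cokernel_epic[OF d(1)] c(2) d(2)]])
      have "d \<cdot> c \<cdot> \<phi> = d \<cdot> h \<cdot> g"
        using Comp_assoc[OF phi c(2) d(2)] Comp_assoc[OF g h(1) d(2)] h(2) by simp
      then show "d \<cdot> c \<cdot> \<phi> = Zero C Y Q"
        using cokernel_zero[OF d(1) h(1) d(2)] Zero_Comp[OF g HomD(5)[OF d(2)]] by simp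
      fix W u assume u: "u \<in> Hom C T W" "u \<cdot> \<phi> = Zero C Y W"
      have oW: "W \<in> Obj C" using HomD(5)[OF u(1)] .
      have "u \<cdot> (\<phi> \<cdot> f) = Zero C X W" using Comp_assoc[OF f phi u(1)] u(2) Zero_Comp[OF f oW] by simp
      then obtain v where v: "v \<in> Hom C D W" "v \<cdot> c = u" using cokernel_factor[OF c(1) pf c(2) u(1)] by metis
      have "v \<cdot> h \<cdot> g = u \<cdot> \<phi>"
        using Comp_assoc[OF g h(1) v(1)] h(2) Comp_assoc[OF phi c(2) v(1)] v(2) by simp
      then have "v \<cdot> h = Zero C Z W" using u(2) epic_zero[OF fg(4) g Comp_Hom[OF h(1) v(1)]] by simp
      then obtain w where w: "w \<in> Hom C Q W" "w \<cdot> d = v" using cokernel_factor[OF d(1) h(1) d(2) v(1)] by metis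
      have "w \<cdot> (d \<cdot> c) = u" using Comp_assoc[OF c(2) d(2) w(1)] w(2) v(2) by simp
      then show "\<exists>w\<in>Hom C Q W. w \<cdot> (d \<cdot> c) = u" using w(1) by blast
    qed
    then show "\<exists>c Q. is_cokernel C \<phi> c \<and> c \<in> Hom C T Q \<and> Q \<in> F" using dc Q by blast
  qed
qed

text \<open>Let \<open>K\<close> be the kernel of \<open>X \<rightarrow> Y\<close> and \<open>\<phi>: K \<rightarrow> T\<close> with \<open>T\<close> in \<open>F\<close>. The pushout \<open>P\<close> of \<open>X\<close> and
  \<open>T\<close> under \<open>K\<close> is an extension of the image of \<open>X\<close> in \<open>Y\<close> by \<open>T\<close>, hence in \<open>F\<close>. The cokernel of
  \<open>\<phi>\<close> is also one of \<open>X \<rightarrow> P\<close>, so it is in \<open>F\<close>.\<close>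

lemma W_R_kernel_closed:
  assumes F: "torsion_free_class C F"
  shows "kernel_closed C (W_R C F)"
  unfolding kernel_closed_def
proof (intro ballI allI impI)
  note Fs = torsion_free_classD[OF F]
  fix X Y f k
  assume X: "X \<in> W_R C F" and Y: "Y \<in> W_R C F" and f: "f \<in> Hom C X Y" and k: "is_kernel C f k"
  define K where "K = Dom C k"
  have kH: "k \<in> Hom C K X" unfolding K_def using kernel_Hom[OF k f] .
  have km: "monic C k" using kernel_monic[OF k] .
  have "K \<in> F" using subobject_closedD[OF Fs(3) km kH] X W_R_subset by blast
  moreover have "\<exists>c Q. is_cokernel C \<phi> c \<and> c \<in> Hom C T Q \<and> Q \<in> F" if T: "T \<in> F" and phi: "\<phi> \<in> Hom C K T" for T \<phi>
  proof -
    obtain I e m where em: "epic C e" "e \<in> Hom C X I" "monic C m" "m \<in> Hom C I Y" "m \<cdot> e = f"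
      using epic_monic_factorization[OF f] .
    have I: "I \<in> F" using subobject_closedD[OF Fs(3) em(3,4)] Y W_R_subset by blast
    have "is_kernel C e k"
    proof (rule is_kernelI[OF em(2) kH _ km])
      have "m \<cdot> (e \<cdot> k) = Zero C K Y" using Comp_assoc[OF kH em(2,4)] em(5) kernel_zero[OF k f kH] by simp
      then show "e \<cdot> k = Zero C K I" using monic_zero[OF em(3,4) Comp_Hom[OF kH em(2)]] by simp
      fix W h assume h: "h \<in> Hom C W X" "e \<cdot> h = Zero C W I"
      have "f \<cdot> h = Zero C W Y"
        using Comp_assoc[OF h(1) em(2,4)] em(5) h(2) Comp_Zero[OF em(4) HomD(4)[OF h(1)]] by simp
      then show "\<exists>u\<in>Hom C W K. k \<cdot> u = h" using kernel_factor[OF k f kH h(1)] by metis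
    qed
    then have se: "short_exact C k e" using epic_short_exact[OF em(1)] by blast
    obtain D d where d: "is_cokernel C \<phi> d" "d \<in> Hom C T D" using cokernelE[OF phi] .
    obtain P a b x d' where P: "a \<in> Hom C T P" "b \<in> Hom C P I" "short_exact C a b"
      "x \<in> Hom C X P" "d' \<in> Hom C P D" "is_cokernel C x d'"
      using pushout[OF se kH em(2) phi d] .
    have "P \<in> F" using extension_closedD[OF Fs(2) P(3,1,2) T I] .
    then have "D \<in> F" using W_RD[OF X _ P(4,6,5)] by blast
    then show ?thesis using d by blast
  qed
  ultimately have "K \<in> W_R C F" using W_RI[OF F] by blast
  then show "Dom C k \<in> W_R C F" unfolding K_def .
qed

lemma W_R_wide:
  assumes F: "torsion_free_class C F"
  shows "wide C (W_R C F)"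
  unfolding wide_def
proof (intro conjI W_R_extension_closed[OF F] W_R_kernel_closed[OF F])
  note Fs = torsion_free_classD[OF F]
  show "cokernel_closed C (W_R C F)"
    unfolding cokernel_closed_def
  proof (intro ballI allI impI)
    fix X Y f c
    assume X: "X \<in> W_R C F" and Y: "Y \<in> W_R C F" and f: "f \<in> Hom C X Y" and c: "is_cokernel C f c"
    have cH: "c \<in> Hom C Y (Cod C c)" using cokernel_Hom[OF c f] .
    have "Cod C c \<in> F" using W_RD[OF X _ f c cH] Y W_R_subset by blast
    then show "Cod C c \<in> W_R C F" using W_R_quotient[OF F Y cokernel_epic[OF c] cH] by blast
  qed
  show "subcategory C (W_R C F)"
    unfolding subcategory_def
  proof (intro conjI ballI impI)
    show "W_R C F \<subseteq> Obj C" using Fs(1) W_R_subset unfolding subcategory_def by blast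
    fix X Y assume X: "X \<in> W_R C F" and iso: "isomorphic C X Y"
    obtain f where f: "f \<in> Hom C X Y" "is_iso C f" using iso unfolding isomorphic_def by blast
    have "Y \<in> F" using subcategory_iso[OF Fs(1) iso] X W_R_subset by blast
    then show "Y \<in> W_R C F" using W_R_quotient[OF F X iso_epic[OF f(2,1)] f(1)] by blast
  next
    obtain Z where Z: "zero_object C Z" using zero_object_ex by blast
    have ZF: "Z \<in> F" using subcategory_zero_object[OF Fs(1) Z] .
    have "Z \<in> W_R C F"
    proof (rule W_RI[OF F ZF])
      fix Y f assume Y: "Y \<in> F" and f: "f \<in> Hom C Z Y"
      have oY: "Y \<in> Obj C" using HomD(5)[OF f] .
      have f0: "f = Zero C Z Y" using zero_object_Hom(2)[OF Z f] .
      have "is_cokernel C f (Ident C Y)"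
      proof (rule is_cokernelI[OF f Ident_Hom[OF oY] _ epic_Ident[OF oY]])
        show "Ident C Y \<cdot> f = Zero C Z Y" using Ident_Comp[OF f] f0 by simp
        fix W h assume "h \<in> Hom C Y W"
        then show "\<exists>u\<in>Hom C Y W. u \<cdot> Ident C Y = h" using Comp_Ident by blast
      qed
      then show "\<exists>c Q. is_cokernel C f c \<and> c \<in> Hom C Y Q \<and> Q \<in> F" using Ident_Hom[OF oY] Y by blast
    qed
    then show "\<exists>Z\<in>W_R C F. zero_object C Z" using Z by blast
  qed
qed

section \<open>The class \<open>F\<^sup>-\<close> and the heart of \<open>[F\<^sup>-, F]\<close>\<close>

text \<open>Take for \<open>I\<close> a longest subobject of \<open>Y\<close> that is in \<open>W_R C F\<close>. If \<open>J\<close> is the image in \<open>Y/I\<close> of an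
  object of \<open>W_R C F\<close>, then its preimage in \<open>Y\<close> is an extension of \<open>J\<close> by \<open>I\<close>, hence in \<open>W_R C F\<close>;
  so it is \<open>I\<close> and \<open>J\<close> is zero.\<close>

lemma torf_minus_sequence:
  assumes F: "torsion_free_class C F" and Y: "Y \<in> F"
  obtains I N i p where "i \<in> Hom C I Y" "p \<in> Hom C Y N" "short_exact C i p" "I \<in> W_R C F" "N \<in> torf_minus C F"
proof -
  note Fs = torsion_free_classD[OF F]
  note W = W_R_wide[OF F]
  have Wsub: "subcategory C (W_R C F)" and WO: "W_R C F \<subseteq> Obj C"
    using W unfolding wide_def subcategory_def by blast+
  define P where "P I \<longleftrightarrow> I \<in> W_R C F \<and> (\<exists>i\<in>Hom C I Y. monic C i)" for I
  obtain I0 where I0: "P I0"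
  proof -
    obtain Z where Z: "zero_object C Z" using zero_object_ex by blast
    have i: "Zero C Z Y \<in> Hom C Z Y"
      using Zero_Hom Z subcategory_Obj[OF Fs(1) Y] unfolding zero_object_def by blast
    have "monic C (Zero C Z Y)" using zero_object_Hom(1)[OF Z] by (intro monicI[OF i])
    then have "P Z" unfolding P_def using i subcategory_zero_object[OF Wsub Z] by blast
    then show thesis by (rule that)
  qed
  have "\<forall>I. P I \<longrightarrow> min_length C I < Suc (min_length C Y)"
    unfolding P_def less_Suc_eq_le using min_length_le by blast
  from ex_has_greatest_nat[OF I0 this]
  obtain I where I: "P I" and max: "\<And>J. P J \<Longrightarrow> min_length C J \<le> min_length C I" by blast
  then obtain i where i: "i \<in> Hom C I Y" "monic C i" and IW: "I \<in> W_R C F" unfolding P_def by blast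
  obtain N p where p: "is_cokernel C i p" "p \<in> Hom C Y N" using cokernelE[OF i(1)] .
  have se: "short_exact C i p" using monic_short_exact[OF i(2) p(1)] .
  have N: "N \<in> F" using W_RD[OF IW Y i(1) p] .
  have "N \<in> right_perp C (W_R C F)"
    unfolding right_perp_iff[OF WO]
  proof (intro conjI allI impI)
    show "N \<in> Obj C" using HomD(5)[OF p(2)] .
    fix X \<phi> assume X: "X \<in> W_R C F" and phi: "\<phi> \<in> Hom C X N"
    obtain J e m where em: "epic C e" "e \<in> Hom C X J" "monic C m" "m \<in> Hom C J N" "m \<cdot> e = \<phi>"
      using epic_monic_factorization[OF phi] .
    have J: "J \<in> W_R C F"
      using W_R_quotient[OF F X em(1,2)] subobject_closedD[OF Fs(3) em(3,4) N] by blast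
    obtain R d where d: "is_cokernel C m d" "d \<in> Hom C N R" using cokernelE[OF em(4)] .
    have md: "is_kernel C d m" using short_exactD(1)[OF monic_short_exact[OF em(3) d(1)]] .
    have dp: "d \<cdot> p \<in> Hom C Y R" using Comp_Hom[OF p(2) d(2)] .
    have dpe: "epic C (d \<cdot> p)"
      using epic_Comp[OF cokernel_epic[OF p(1)] cokernel_epic[OF d(1)] p(2) d(2)] .
    obtain J' j where j: "is_kernel C (d \<cdot> p) j" "j \<in> Hom C J' Y" using kernelE[OF dp] .
    have sej: "short_exact C j (d \<cdot> p)" using epic_short_exact[OF dpe j(1)] .
    have "d \<cdot> p \<cdot> i = Zero C I R"
      using Comp_assoc[OF i(1) p(2) d(2)] cokernel_zero[OF p(1) i(1) p(2)]
        Comp_Zero[OF d(2) HomD(4)[OF i(1)]] by simp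
    then obtain i' where i': "i' \<in> Hom C I J'" "j \<cdot> i' = i" using kernel_factor[OF j(1) dp j(2) i(1)] by metis
    have im: "monic C i'" using monic_right_factor[OF _ i'(1) j(2)] i'(2) i(2) by simp
    obtain D c where c: "is_cokernel C i' c" "c \<in> Hom C J' D" using cokernelE[OF i'(1)] .
    have pj: "is_cokernel C (j \<cdot> i') p" using i'(2) p(1) by simp
    \<comment> \<open>\<open>0 \<rightarrow> J'/I \<rightarrow> Y/I \<rightarrow> Y/J' \<rightarrow> 0\<close>, so \<open>D = J'/I\<close> and \<open>J\<close> are kernels of the same \<open>d\<close>.\<close>
    obtain a b where ab: "a \<in> Hom C D N" "b \<in> Hom C N R" "a \<cdot> c = p \<cdot> j" "b \<cdot> p = d \<cdot> p" "short_exact C a b"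
      using third_isomorphism[OF i'(1) j(2) sej dp c pj p(2)] .
    have bd: "b = d" using epic_cancel[OF cokernel_epic[OF p(1)] p(2) ab(2) d(2) ab(4)] .
    have ad: "is_kernel C d a" using short_exactD(1)[OF ab(5)] bd by simp
    have "D \<in> W_R C F"
      using subcategory_iso[OF Wsub kernel_isomorphic[OF md em(4) ad ab(1)] J] .
    then have "J' \<in> W_R C F"
      using extension_closedD[OF W_R_extension_closed[OF F] monic_short_exact[OF im c(1)] i'(1) c(2) IW]
      by blast
    then have "P J'" unfolding P_def using j(2) kernel_monic[OF j(1)] by blast
    then have iso: "is_iso C i'" using max min_length_less[OF im i'(1)] by (meson not_less)
    have "c = Zero C J' D"
      using epic_zero[OF iso_epic[OF iso i'(1)] i'(1) c(2) cokernel_zero[OF c(1) i'(1) c(2)]] .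
    then have "a \<cdot> c = Zero C J' N" using Comp_Zero[OF ab(1) HomD(5)[OF i'(1)]] by simp
    then have a0: "a = Zero C D N" using epic_zero[OF cokernel_epic[OF c(1)] c(2) ab(1)] by blast
    obtain w where w: "w \<in> Hom C J D" "a \<cdot> w = m"
      using kernel_factor[OF ad d(2) ab(1) em(4) kernel_zero[OF md d(2) em(4)]] .
    have "m = Zero C J N" using w(2) a0 Zero_Comp[OF w(1) HomD(5)[OF p(2)]] by simp
    then show "\<phi> = Zero C X N" using em(5) Zero_Comp[OF em(2) HomD(5)[OF p(2)]] by simp
  qed
  then have "N \<in> torf_minus C F" unfolding torf_minus_def using N by blast
  then show thesis using that i(1) p(2) se IW by blast
qed

lemma torf_minus_torsion_free:
  assumes F: "torsion_free_class C F"
  shows "torsion_free_class C (torf_minus C F)"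
  unfolding torsion_free_class_def
proof (intro conjI)
  note Fs = torsion_free_classD[OF F]
  have WO: "W_R C F \<subseteq> Obj C" using W_R_wide[OF F] unfolding wide_def subcategory_def by blast
  have sub: "X \<in> torf_minus C F" if "monic C m" "m \<in> Hom C X Y" "Y \<in> torf_minus C F" for m X Y
    using that subobject_closedD[OF Fs(3)] right_perp_subobject[OF WO] unfolding torf_minus_def by blast
  show "subobject_closed C (torf_minus C F)"
    unfolding subobject_closed_def
  proof (intro allI impI)
    fix f assume f: "monic C f \<and> Cod C f \<in> torf_minus C F"
    then have "f \<in> Hom C (Dom C f) (Cod C f)" unfolding monic_def Hom_iff by blast
    then show "Dom C f \<in> torf_minus C F" using sub f by blast
  qed
  show "extension_closed C (torf_minus C F)"
  proof (rule extension_closedI)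
    fix f g X Y Z
    assume "short_exact C f g" "f \<in> Hom C X Y" "g \<in> Hom C Y Z" "X \<in> torf_minus C F" "Z \<in> torf_minus C F"
    then show "Y \<in> torf_minus C F"
      using extension_closedD[OF Fs(2)] right_perp_extension[OF WO] unfolding torf_minus_def by blast
  qed
  show "subcategory C (torf_minus C F)"
    unfolding subcategory_def
  proof (intro conjI ballI impI)
    show "torf_minus C F \<subseteq> Obj C" using Fs(1) unfolding torf_minus_def subcategory_def by blast
    fix X Y assume X: "X \<in> torf_minus C F" and "isomorphic C X Y"
    then obtain f where f: "f \<in> Hom C X Y" "is_iso C f" unfolding isomorphic_def by blast
    obtain g where g: "g \<in> Hom C Y X" "is_iso C g" using is_iso_inverse[OF f(2,1)] .
    show "Y \<in> torf_minus C F" using sub[OF iso_monic[OF g(2,1)] g(1) X] .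
  next
    obtain Z where Z: "zero_object C Z" using zero_object_ex by blast
    have "Z \<in> right_perp C (W_R C F)"
      unfolding right_perp_iff[OF WO]
    proof (intro conjI allI impI)
      show "Z \<in> Obj C" using Z unfolding zero_object_def by blast
      fix X f assume "f \<in> Hom C X Z"
      then show "f = Zero C X Z" using zero_object_Hom(1)[OF Z] by blast
    qed
    then have "Z \<in> torf_minus C F"
      using subcategory_zero_object[OF Fs(1) Z] unfolding torf_minus_def by blast
    then show "\<exists>Z\<in>torf_minus C F. zero_object C Z" using Z by blast
  qed
qed

text \<open>If \<open>Y\<close> has no nonzero morphism to \<open>F\<^sup>-\<close>, then in the sequence \<open>0 \<rightarrow> I \<rightarrow> Y \<rightarrow> N \<rightarrow> 0\<close> above the
  quotient \<open>N\<close> vanishes and \<open>Y\<close> is \<open>I\<close>.\<close>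

lemma heart_torf_minus:
  assumes F: "torsion_free_class C F"
  shows "heart C (torf_minus C F) F = W_R C F"
proof
  note Fs = torsion_free_classD[OF F]
  have O: "torf_minus C F \<subseteq> Obj C" "W_R C F \<subseteq> Obj C"
    using Fs(1) W_R_subset unfolding torf_minus_def subcategory_def by blast+
  show "W_R C F \<subseteq> heart C (torf_minus C F) F"
  proof
    fix X assume X: "X \<in> W_R C F"
    have "X \<in> left_perp C (torf_minus C F)"
      unfolding left_perp_iff[OF O(1)]
    proof (intro conjI allI impI)
      show "X \<in> Obj C" using X O(2) by blast
      fix Y f assume "Y \<in> torf_minus C F" and f: "f \<in> Hom C X Y"
      then have "Y \<in> right_perp C (W_R C F)" unfolding torf_minus_def by blast
      then show "f = Zero C X Y" using X f unfolding right_perp_iff[OF O(2)] by blast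
    qed
    then show "X \<in> heart C (torf_minus C F) F" using X W_R_subset unfolding heart_def by blast
  qed
  show "heart C (torf_minus C F) F \<subseteq> W_R C F"
  proof
    fix Y assume "Y \<in> heart C (torf_minus C F) F"
    then have Y: "Y \<in> F" and perp: "Y \<in> left_perp C (torf_minus C F)" unfolding heart_def by blast+
    obtain I N i p where s: "i \<in> Hom C I Y" "p \<in> Hom C Y N" "short_exact C i p" "I \<in> W_R C F" "N \<in> torf_minus C F"
      using torf_minus_sequence[OF F Y] .
    have "p = Zero C Y N" using perp s(2,5) unfolding left_perp_iff[OF O(1)] by blast
    then have "epic C i"
    proof (intro epicI[OF s(1)])
      fix W g assume p0: "p = Zero C Y N" and g: "g \<in> Hom C Y W" "g \<cdot> i = Zero C I W"
      obtain u where u: "u \<in> Hom C N W" "u \<cdot> p = g"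
        using cokernel_factor[OF short_exactD(2)[OF s(3)] s(1,2) g] .
      show "g = Zero C Y W" using u p0 Comp_Zero[OF u(1) HomD(4)[OF s(2)]] by simp
    qed
    then show "Y \<in> W_R C F" using W_R_quotient[OF F s(4) _ s(1) Y] by blast
  qed
qed

section \<open>Wide and ICE intervals\<close>

lemma torf_intervalD:
  assumes "torf_interval C G F"
  shows "torsion_free_class C F" "torsion_free_class C G" "G \<subseteq> F" "G \<subseteq> Obj C"
proof -
  show "torsion_free_class C F" and G: "torsion_free_class C G" and "G \<subseteq> F"
    using assms unfolding torf_interval_def torf_def by simp_all
  show "G \<subseteq> Obj C" using subcategory_Obj[OF torsion_free_classD(1)[OF G]] by blast
qed

text \<open>Let \<open>W\<close> be the heart of \<open>[G', F]\<close>. A quotient inside \<open>W\<close> of an object of the smaller heart is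
  also a quotient in \<open>C\<close>, so it stays in \<open>\<^sup>\<bottom>G\<close>, and it is in \<open>F\<close> because \<open>W\<close> is.\<close>

lemma heart_torsion_class:
  assumes G: "torf_interval C G F" and G': "G' \<subseteq> G" "wide C (heart C G' F)"
  shows "torsion_class (full_subcategory C (heart C G' F)) (heart C G F)"
proof -
  define W where "W = heart C G' F"
  note F = torf_intervalD(1)[OF G] and GO = torf_intervalD(4)[OF G]
  have W: "wide C W" using G'(2) unfolding W_def .
  have WO: "W \<subseteq> Obj C" using W unfolding wide_def subcategory_def by blast
  have HW: "heart C G F \<subseteq> W" unfolding W_def heart_def using left_perp_antimono[OF G'(1)] by blast
  note Hs = heart_subcategory[OF F GO]
  have "subcategory (full_subcategory C W) (heart C G F)"
    unfolding subcategory_def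
  proof (intro conjI ballI impI)
    show "heart C G F \<subseteq> Obj (full_subcategory C W)" using HW by simp
    fix X Y assume "X \<in> heart C G F" "isomorphic (full_subcategory C W) X Y"
    then show "Y \<in> heart C G F" using subcategory_iso[OF Hs] full_subcategory_isomorphic by blast
  next
    obtain Z where Z: "Z \<in> heart C G F" "zero_object C Z" using Hs unfolding subcategory_def by blast
    then show "\<exists>Z\<in>heart C G F. zero_object (full_subcategory C W) Z"
      using full_subcategory_zero_object[OF WO] HW by blast
  qed
  moreover have "extension_closed (full_subcategory C W) (heart C G F)"
    unfolding extension_closed_def
  proof (intro allI impI)
    fix f g
    assume fg: "short_exact (full_subcategory C W) f g \<and>
      Dom (full_subcategory C W) f \<in> heart C G F \<and> Cod (full_subcategory C W) g \<in> heart C G F"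
    then have "short_exact C f g"
      using full_subcategory_kernel[OF W] full_subcategory_cokernel[OF W] unfolding short_exact_def by blast
    then show "Cod (full_subcategory C W) f \<in> heart C G F"
      using fg heart_extension_closed[OF F GO] unfolding extension_closed_def full_subcategory_simps
      by blast
  qed
  moreover have "quotient_closed (full_subcategory C W) (heart C G F)"
    unfolding quotient_closed_def
  proof (intro allI impI)
    fix f assume f: "epic (full_subcategory C W) f \<and> Dom (full_subcategory C W) f \<in> heart C G F"
    then have e: "epic C f" using full_subcategory_epic[OF W] by blast
    have "f \<in> Arr (full_subcategory C W)" using f unfolding epic_def by blast
    then have fH: "f \<in> Hom C (Dom C f) (Cod C f)" and Y: "Cod C f \<in> W" by (simp_all add: Hom_iff)
    have X: "Dom C f \<in> heart C G F" using f by simp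
    have "Cod C f \<in> left_perp C G" using left_perp_quotient[OF GO _ e fH] X unfolding heart_def by blast
    then show "Cod (full_subcategory C W) f \<in> heart C G F"
      using Y unfolding W_def heart_def by simp
  qed
  ultimately show ?thesis unfolding torsion_class_def W_def by blast
qed

text \<open>Images and cokernels of morphisms of the heart are quotients of objects of \<open>\<^sup>\<bottom>G\<close>, so they stay
  there. Images are in \<open>F\<close> as subobjects; cokernels are in \<open>F\<close> because they are in the wide
  heart of \<open>[G', F]\<close>.\<close>

lemma wide_interval_imp_ICE_interval:
  assumes G: "torf_interval C G F" and G': "G' \<subseteq> G" "wide C (heart C G' F)"
  shows "ICE_interval C G F"
proof -
  note F = torf_intervalD(1)[OF G] and GO = torf_intervalD(4)[OF G]
  have HW: "heart C G F \<subseteq> heart C G' F" unfolding heart_def using left_perp_antimono[OF G'(1)] by blast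
  have HF: "heart C G F \<subseteq> F" "heart C G F \<subseteq> left_perp C G" unfolding heart_def by blast+
  have "image_closed C (heart C G F)"
    unfolding image_closed_def
  proof (intro ballI allI impI)
    fix X Y f m
    assume X: "X \<in> heart C G F" and Y: "Y \<in> heart C G F" and f: "f \<in> Hom C X Y" and im: "is_image C f m"
    obtain c where c: "is_cokernel C f c" "is_kernel C c m" using im unfolding is_image_def by blast
    have mH: "m \<in> Hom C (Dom C m) Y" using kernel_Hom[OF c(2) cokernel_Hom[OF c(1) f]] .
    obtain e where e: "epic C e" "e \<in> Hom C X (Dom C m)" "monic C m"
      using image_factorization[OF f im mH] .
    have "Dom C m \<in> F" using subobject_closedD[OF torsion_free_classD(3)[OF F] e(3) mH] Y HF by blast
    moreover have "Dom C m \<in> left_perp C G" using left_perp_quotient[OF GO _ e(1,2)] X HF by blast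
    ultimately show "Dom C m \<in> heart C G F" unfolding heart_def by blast
  qed
  moreover have "cokernel_closed C (heart C G F)"
    unfolding cokernel_closed_def
  proof (intro ballI allI impI)
    fix X Y f c
    assume X: "X \<in> heart C G F" and Y: "Y \<in> heart C G F" and f: "f \<in> Hom C X Y" and c: "is_cokernel C f c"
    have "Cod C c \<in> heart C G' F"
      using G'(2) X Y HW f c unfolding wide_def cokernel_closed_def by blast
    moreover have "Cod C c \<in> left_perp C G"
      using left_perp_quotient[OF GO _ cokernel_epic[OF c] cokernel_Hom[OF c f]] Y HF by blast
    ultimately show "Cod C c \<in> heart C G F" unfolding heart_def by blast
  qed
  ultimately show ?thesis
    unfolding ICE_interval_def ICE_closed_def
    using G heart_subcategory[OF F GO] heart_extension_closed[OF F GO] by blast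
qed

text \<open>Given \<open>f: X \<rightarrow> Y\<close> with \<open>X\<close> in the heart and \<open>Y\<close> in \<open>F\<close>, the map \<open>f\<close> lands in the torsion part
  \<open>K\<close> of \<open>Y\<close>, which is in the heart. So \<open>K/X\<close> is in the heart and \<open>Y/X\<close> is an extension of
  \<open>Y/K\<close> by \<open>K/X\<close>, both in \<open>F\<close>.\<close>

lemma heart_subset_W_R:
  assumes int: "torf_interval C G F" and cok: "cokernel_closed C (heart C G F)"
  shows "heart C G F \<subseteq> W_R C F"
proof
  note F = torf_intervalD(1)[OF int] and G = torf_intervalD(2)[OF int]
    and GF = torf_intervalD(3)[OF int] and GO = torf_intervalD(4)[OF int]
  note Fs = torsion_free_classD[OF F]
  fix X assume X: "X \<in> heart C G F"
  then have XF: "X \<in> F" and Xp: "X \<in> left_perp C G" unfolding heart_def by blast+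
  show "X \<in> W_R C F"
  proof (rule W_RI[OF F XF])
    fix Y f assume Y: "Y \<in> F" and f: "f \<in> Hom C X Y"
    obtain K N k p where s: "k \<in> Hom C K Y" "p \<in> Hom C Y N" "short_exact C k p" "K \<in> left_perp C G" "N \<in> G"
      using torsion_sequence[OF G HomD(5)[OF f]] .
    note kp = short_exactD[OF s(3)]
    have KH: "K \<in> heart C G F"
      using subobject_closedD[OF Fs(3) kp(3) s(1) Y] s(4) unfolding heart_def by blast
    have "p \<cdot> f = Zero C X N" using Xp s(5) Comp_Hom[OF f s(2)] unfolding left_perp_iff[OF GO] by blast
    then obtain f' where f': "f' \<in> Hom C X K" "k \<cdot> f' = f" using kernel_factor[OF kp(1) s(2,1) f] by metis
    obtain D c' where c': "is_cokernel C f' c'" "c' \<in> Hom C K D" using cokernelE[OF f'(1)] .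
    have "Cod C c' \<in> heart C G F"
      using cok X KH f'(1) c'(1) unfolding cokernel_closed_def by blast
    then have D: "D \<in> F" using HomD(3)[OF c'(2)] unfolding heart_def by simp
    obtain E c where c: "is_cokernel C f c" "c \<in> Hom C Y E" using cokernelE[OF f] .
    have kc: "is_cokernel C (k \<cdot> f') c" using c(1) f'(2) by simp
    obtain j p' where "j \<in> Hom C D E" "p' \<in> Hom C E N" "short_exact C j p'"
      using third_isomorphism[OF f'(1) s(1,3,2) c' kc c(2)] by metis
    then have "E \<in> F" using extension_closedD[OF Fs(2)] D s(5) GF by blast
    then show "\<exists>c Q. is_cokernel C f c \<and> c \<in> Hom C Y Q \<and> Q \<in> F" using c by blast
  qed
qed

text \<open>For \<open>M\<close> in \<open>F\<^sup>-\<close>, the torsion part of \<open>M\<close> with respect to \<open>G\<close> is in the heart and so in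
  \<open>W_R C F\<close>. It embeds into \<open>M\<close>, which receives only zero morphisms from there, so it is zero and
  \<open>M\<close> is in \<open>G\<close>.\<close>

lemma ICE_interval_imp_torf_minus_subset:
  assumes "ICE_interval C G F"
  shows "torf_minus C F \<subseteq> G"
proof
  have int: "torf_interval C G F" and cok: "cokernel_closed C (heart C G F)"
    using assms unfolding ICE_interval_def ICE_closed_def by blast+
  note F = torf_intervalD(1)[OF int] and G = torf_intervalD(2)[OF int]
  note Fs = torsion_free_classD[OF F]
  have WO: "W_R C F \<subseteq> Obj C" using Fs(1) W_R_subset unfolding subcategory_def by blast
  fix M assume M: "M \<in> torf_minus C F"
  then have MF: "M \<in> F" and Mp: "M \<in> right_perp C (W_R C F)" unfolding torf_minus_def by blast+
  obtain K N k p where s: "k \<in> Hom C K M" "p \<in> Hom C M N" "short_exact C k p" "K \<in> left_perp C G" "N \<in> G"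
    using torsion_sequence[OF G subcategory_Obj[OF Fs(1) MF]] .
  note kp = short_exactD[OF s(3)]
  have "K \<in> heart C G F"
    using subobject_closedD[OF Fs(3) kp(3) s(1) MF] s(4) unfolding heart_def by blast
  then have "K \<in> W_R C F" using heart_subset_W_R[OF int cok] by blast
  then have k0: "k = Zero C K M" using Mp s(1) unfolding right_perp_iff[OF WO] by blast
  have "monic C p"
  proof (rule monicI[OF s(2)])
    fix W g assume g: "g \<in> Hom C W M" "p \<cdot> g = Zero C W N"
    obtain u where u: "u \<in> Hom C W K" "k \<cdot> u = g" using kernel_factor[OF kp(1) s(2,1) g] .
    show "g = Zero C W M" using u k0 Zero_Comp[OF u(1) HomD(5)[OF s(1)]] by simp
  qed
  then show "M \<in> G" using subobject_closedD[OF torsion_free_classD(3)[OF G] _ s(2,5)] by blast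
qed

end

theorem theorem3p4:
  fixes C :: "('o, 'm) category" and G F :: "'o set"
  assumes "abelian_length_category C"
    and "torf_interval C G F"
  shows "((torf_minus C F \<subseteq> G \<and> G \<subseteq> F) \<longleftrightarrow>
            (\<exists>G'\<in>torf C. G' \<subseteq> G \<and> G \<subseteq> F \<and> wide_interval C G' F))
       \<and> ((\<exists>G'\<in>torf C. G' \<subseteq> G \<and> G \<subseteq> F \<and> wide_interval C G' F) \<longleftrightarrow>
            ICE_interval C G F)
       \<and> (\<forall>G'\<in>torf C. G' \<subseteq> G \<and> G \<subseteq> F \<and> wide_interval C G' F \<longrightarrow>
            torsion_class (full_subcategory C (heart C G' F)) (heart C G F))
       \<and> (ICE_interval C G F \<longrightarrow>
            torsion_class (full_subcategory C (W_R C F)) (heart C G F))"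
proof -
  interpret abelian_length_category C using assms(1) .
  note F = torf_intervalD(1)[OF assms(2)] and GF = torf_intervalD(3)[OF assms(2)]
  note minus = torf_minus_torsion_free[OF F] heart_torf_minus[OF F] W_R_wide[OF F]
  have minus_torf: "torf_minus C F \<in> torf C" using minus(1) unfolding torf_def by blast
  have minus_wide: "wide_interval C (torf_minus C F) F"
    using minus minus_torf assms(2) unfolding wide_interval_def torf_interval_def torf_minus_def by auto
  have 1: "\<exists>G'\<in>torf C. G' \<subseteq> G \<and> G \<subseteq> F \<and> wide_interval C G' F" if "torf_minus C F \<subseteq> G"
    using that minus_torf minus_wide GF by blast
  have 2: "ICE_interval C G F" if "\<exists>G'\<in>torf C. G' \<subseteq> G \<and> G \<subseteq> F \<and> wide_interval C G' F"
    using that wide_interval_imp_ICE_interval[OF assms(2)] unfolding wide_interval_def by blast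
  have 3: "torf_minus C F \<subseteq> G" if "ICE_interval C G F"
    using ICE_interval_imp_torf_minus_subset[OF that] .
  have 4: "torsion_class (full_subcategory C (heart C G' F)) (heart C G F)"
    if "G' \<subseteq> G" "wide_interval C G' F" for G'
    using heart_torsion_class[OF assms(2)] that unfolding wide_interval_def by blast
  have "torsion_class (full_subcategory C (W_R C F)) (heart C G F)" if "ICE_interval C G F"
    using 4[OF 3[OF that] minus_wide] minus(2) by simp
  then show ?thesis using 1 2 3 4 GF by blast
qed

end
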